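(* Let $f_C:[0,\infty)^2\to\mathbb{R}$ be the continuous function defined in the context and set $F_C(x,y,z)=f_C(x,y)+f_C(y,z)+f_C(z,x)$. Then for all $x,y,z\in[0,1]$ $$F_C(x,y,z)\le 8xyz,$$ and equality $F_C(x,y,z)=8xyz$ holds if and only if $(x,y,z)$ belongs to the closure of the set $\{(x,y,z)\in[0,1]^3:\ x\oplus y\oplus z=0\}$. In particular, the triple of functions $\frac18 f_C(x,y),\ \frac18 f_C(y,z),\ \frac18 f_C(z,x)$ on $[0,1]^2$ solves the following dual problem: maximize $$\int_{[0,1]^2}F(x,y)\,dx\,dy+\int_{[0,1]^2}G(y,z)\,dy\,dz+\int_{[0,1]^2}H(z,x)\,dx\,dz$$ over triples of Lebesgue integrable functions $F,G,H$ on $[0,1]^2$ satisfying $F(x,y)+G(y,z)+H(z,x)\le xyz$ for all $x,y,z\in[0,1]$.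
   Context: Definition of $f$: $f:\mathbb{N}_0\times\mathbb{N}_0\to\mathbb{Z}$ ($\mathbb{N}_0$ the non-negative integers) is given by $f(0,0)=0$, $f(0,1)=f(1,0)=-1$, $f(1,1)=2$, and at all other points by the recurrence - $f(a,b)=8f(\frac a2,\frac b2)$ if $a,b$ are both even; - $f(a,b)=4\big(f(\frac{a-1}2,\frac b2)+f(\frac{a+1}2,\frac b2)\big)+3$ if $a$ is odd and $b$ is even; - $f(a,b)=4\big(f(\frac a2,\frac{b-1}2)+f(\frac a2,\frac{b+1}2)\big)+3$ if $a$ is even and $b$ is odd; - $f(a,b)=2\big(f(\frac{a-1}2,\frac{b-1}2)+f(\frac{a-1}2,\frac{b+1}2)+f(\frac{a+1}2,\frac{b-1}2)+f(\frac{a+1}2,\frac{b+1}2)\big)+2$ if $a,b$ are both odd. Definition of $f_C$: for non-negative dyadic rationals, $f_C(\frac a{2^n},\frac b{2^n})=8^{-n}f(a,b)$ ($a,b,n\in\mathbb{N}_0$), which is well defined since $f(2a,2b)=8f(a,b)$; $f_C$ on $[0,\infty)^2$ is the (unique, existing) continuous extension of this function. Bitwise addition: numbers in $[0,1]$ are written in binary as $x=\sum_{i\ge1}x_i2^{-i}$, where dyadic rationals less than $1$ are written with finitely many digits $1$ and $1=0.1111\ldots$; $x\oplus y$ is obtained by adding digits modulo 2. The condition $x\oplus y\oplus z=0$ means $x_i+y_i+z_i\equiv0\pmod 2$ for every $i\ge1$. *)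

theory Defs
  imports "HOL-Analysis.Analysis"
begin

function f_int :: "nat \<Rightarrow> nat \<Rightarrow> int" where
  "f_int a b =
    (if a = 0 \<and> b = 0 then 0
     else if (a = 0 \<and> b = 1) \<or> (a = 1 \<and> b = 0) then - 1
     else if a = 1 \<and> b = 1 then 2
     else if even a \<and> even b then
       8 * f_int (a div 2) (b div 2)
     else if odd a \<and> even b then
       4 * (f_int ((a - 1) div 2) (b div 2) + f_int ((a + 1) div 2) (b div 2)) + 3
     else if even a \<and> odd b then
       4 * (f_int (a div 2) ((b - 1) div 2) + f_int (a div 2) ((b + 1) div 2)) + 3
     else
       2 * (f_int ((a - 1) div 2) ((b - 1) div 2) + f_int ((a - 1) div 2) ((b + 1) div 2)
          + f_int ((a + 1) div 2) ((b - 1) div 2) + f_int ((a + 1) div 2) ((b + 1) div 2)) + 2)"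
  by pat_completeness auto
termination
  by (relation "Wellfounded.measure (\<lambda>(a, b). a + b)") (auto elim!: evenE oddE)

declare f_int.simps [simp del]

definition quadrant :: "(real \<times> real) set" where
  "quadrant = {0..} \<times> {0..}"

text \<open>Dyadic points are dense in the quadrant, so a continuous function is determined there by
  the second condition; the condition \<open>g \<in> extensional quadrant\<close> only fixes the irrelevant values
  outside the quadrant, so that \<open>THE\<close> can be used.\<close>

definition f_C :: "real \<times> real \<Rightarrow> real" where
  "f_C = (THE g. continuous_on quadrant g
             \<and> (\<forall>a b n :: nat. g (real a / 2 ^ n, real b / 2 ^ n) = of_int (f_int a b) / 8 ^ n)
             \<and> g \<in> extensional quadrant)"

definition F_C :: "real \<Rightarrow> real \<Rightarrow> real \<Rightarrow> real" where
  "F_C x y z = f_C (x, y) + f_C (y, z) + f_C (z, x)"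

definition dyadic_rational :: "real \<Rightarrow> bool" where
  "dyadic_rational x \<longleftrightarrow> (\<exists>(k :: int) (n :: nat). x = of_int k / 2 ^ n)"

text \<open>Indices are shifted by one: \<open>d i\<close> is the digit with weight \<open>2 ^ - (i + 1)\<close>. There is no digit
  before the binary point, so the only expansion of 1 is \<open>0.111\<dots>\<close>, and the second
  condition is needed for dyadic rationals less than 1 only.\<close>

definition binary_expansion :: "real \<Rightarrow> (nat \<Rightarrow> nat) \<Rightarrow> bool" where
  "binary_expansion x d \<longleftrightarrow>
     (\<forall>i. d i \<in> {0, 1}) \<and> (\<lambda>i. real (d i) / 2 ^ Suc i) sums x
     \<and> (dyadic_rational x \<and> x < 1 \<longrightarrow> finite {i. d i = 1})"

definition binary_digit :: "real \<Rightarrow> nat \<Rightarrow> nat" where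
  "binary_digit x = (THE d. binary_expansion x d)"

definition xor_zero_set :: "(real \<times> real \<times> real) set" where
  "xor_zero_set = {(x, y, z). x \<in> {0..1} \<and> y \<in> {0..1} \<and> z \<in> {0..1}
     \<and> (\<forall>i. (binary_digit x i + binary_digit y i + binary_digit z i) mod 2 = 0)}"

definition unit_square :: "(real \<times> real) set" where
  "unit_square = {0..1} \<times> {0..1}"

text \<open>The arguments of the third function are ordered \<open>(z, x)\<close>. Values outside the unit square
  play no role.\<close>

type_synonym potentials =
  "(real \<times> real \<Rightarrow> real) \<times> (real \<times> real \<Rightarrow> real) \<times> (real \<times> real \<Rightarrow> real)"

definition dual_feasible :: "potentials \<Rightarrow> bool" where
  "dual_feasible = (\<lambda>(F, G, H).
     set_integrable lebesgue unit_square F \<and> set_integrable lebesgue unit_square G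
     \<and> set_integrable lebesgue unit_square H
     \<and> (\<forall>x\<in>{0..1}. \<forall>y\<in>{0..1}. \<forall>z\<in>{0..1}. F (x, y) + G (y, z) + H (z, x) \<le> x * y * z))"

definition dual_value :: "potentials \<Rightarrow> real" where
  "dual_value = (\<lambda>(F, G, H).
     set_lebesgue_integral lebesgue unit_square F + set_lebesgue_integral lebesgue unit_square G
     + set_lebesgue_integral lebesgue unit_square H)"

end

theory Submission
  imports Defs
begin

text \<open>
  On the unit square \<open>f_C (x, y) = 4 x y - x - y + (\<Sum>n. 8\<^sup>-\<^sup>n\<^sup>-\<^sup>1 * bump (T (2\<^sup>n x)) (T (2\<^sup>n y)))\<close> with the
  tent function \<open>T\<close>. Hence the deficit \<open>gap x y z = 8 x y z - F_C x y z\<close> is self-similar. Cut the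
  cube into eight subcubes indexed by the first binary digits. On the four subcubes of even digit sum,
  \<open>gap\<close> is \<open>1/8\<close> of its rescaled copy. On the other four it is \<open>1/8\<close> of a reflected copy plus a
  nonnegative product, which vanishes only on faces shared with even subcubes. As \<open>gap\<close> is bounded,
  iteration gives \<open>gap \<ge> 0\<close>, with equality exactly at the points that stay in even subcubes for ever,
  which are the limits of points with vanishing digitwise sum. For the dual problem, the excess of
  feasible potentials over \<open>f_C / 8\<close> is bounded by a multiple of \<open>gap\<close>; averaging it over the
  even subcubes keeps its integral and divides the bound by 8, so the integral is at most 0.
\<close>

section \<open>The series for the function on the unit square\<close>

text \<open>The tent function of period 1, twice the distance to the nearest integer. In this form
  continuity, periodicity and evenness are inherited from the cosine.\<close>

definition tent :: "real \<Rightarrow> real" where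
  "tent x = arccos (cos (2 * pi * x)) / pi"

lemma continuous_on_tent [continuous_intros]:
  fixes g :: "'a::t2_space \<Rightarrow> real"
  shows "continuous_on A g \<Longrightarrow> continuous_on A (\<lambda>x. tent (g x))"
  unfolding tent_def by (intro continuous_intros) auto

lemma tent_bounds: "0 \<le> tent x" "tent x \<le> 1"
  unfolding tent_def using arccos_lbound[of "cos (2*pi*x)"] arccos_ubound[of "cos (2*pi*x)"]
  by (auto simp: field_simps)

lemma tent_periodic [simp]: "tent (x + 1) = tent x"
  unfolding tent_def by (simp add: distrib_left)

lemma tent_periodic_nat [simp]: "tent (x + of_nat n) = tent x"
proof (induction n)
  case (Suc n)
  then show ?case using tent_periodic[of "x + of_nat n"] by (simp add: algebra_simps)
qed simp

lemma tent_minus [simp]: "tent (- x) = tent x"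
  unfolding tent_def by simp

lemma tent_left: "0 \<le> x \<Longrightarrow> x \<le> 1/2 \<Longrightarrow> tent x = 2 * x"
  unfolding tent_def by (subst arccos_cos) auto

lemma tent_right:
  assumes "1/2 \<le> x" "x \<le> 1"
  shows "tent x = 2 - 2 * x"
  using tent_left[of "1 - x"] tent_periodic[of "-x"] assms by simp

lemma tent_nat [simp]: "tent (of_nat n) = 0"
  using tent_periodic_nat[of 0 n] tent_left[of 0] by simp

lemma tent_half_integer [simp]: "tent (of_nat n + 1/2) = 1"
  using tent_periodic_nat[of "1/2" n] tent_left[of "1/2"] by (simp add: add.commute)

lemma tent_affine:
  assumes "0 \<le> t" "t \<le> 1/2"
  shows "tent (real j / 2 + t) = (if even j then 2 * t else 1 - 2 * t)"
proof (cases "even j")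
  case True
  then obtain i where "j = 2 * i" by (elim evenE)
  then show ?thesis using tent_periodic_nat[of t i] assms by (simp add: tent_left add.commute)
next
  case False
  then obtain i where "j = 2 * i + 1" by (elim oddE)
  then show ?thesis using tent_periodic_nat[of "1/2 + t" i] assms
    by (simp add: tent_right add_divide_distrib add.commute add.left_commute)
qed

text \<open>The kinks of \<open>tent\<close> are the half-integers, and all of these lie on the grid
  of mesh \<open>1 / 2 ^ (k + 1)\<close>. Hence \<open>tent\<close> is affine between neighbouring
  grid points.\<close>

lemma tent_midpoint:
  "tent (real (2 * a + 1) / 2 ^ (k + 2)) = (tent (real a / 2 ^ (k + 1)) + tent (real (a + 1) / 2 ^ (k + 1))) / 2"
proof -
  \<comment> \<open>\<open>j / 2\<close> is the last half-integer up to
    \<open>a / 2 ^ (k + 1)\<close>, and \<open>r\<close> counts the grid steps beyond it.\<close>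
  define j r where "j = a div 2 ^ k" and "r = a mod 2 ^ k"
  have a: "a = j * 2 ^ k + r" and r: "r < 2 ^ k" by (simp_all add: j_def r_def div_mult_mod_eq)
  from r have r': "real r + 1 \<le> 2 ^ k"
    using of_nat_mono[of "r + 1" "2 ^ k", where 'a = real] by simp
  have 1: "real a / 2 ^ (k+1) = real j / 2 + real r / 2 ^ (k+1)"
    "real (a+1) / 2 ^ (k+1) = real j / 2 + (real r + 1) / 2 ^ (k+1)"
    "real (2*a+1) / 2 ^ (k+2) = real j / 2 + (2 * real r + 1) / 2 ^ (k+2)"
    by (simp_all add: a field_simps)
  have "real r \<le> 2 ^ k" using r' by linarith
  then have 2: "real r / 2 ^ (k+1) \<le> 1/2" "(real r + 1) / 2 ^ (k+1) \<le> 1/2" "(2 * real r + 1) / 2 ^ (k+2) \<le> 1/2"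
    using r' by (simp_all add: field_simps)
  have 3: "(2 * real r + 1) / 2 ^ (k+2) = (real r / 2 ^ (k+1) + (real r + 1) / 2 ^ (k+1)) / 2"
    by (simp add: field_simps)
  have nonneg: "0 \<le> real r / 2 ^ (k+1)" "0 \<le> (real r + 1) / 2 ^ (k+1)" "0 \<le> (2 * real r + 1) / 2 ^ (k+2)"
    by simp_all
  show ?thesis unfolding 1 tent_affine[OF nonneg(1) 2(1)] tent_affine[OF nonneg(2) 2(2)] tent_affine[OF nonneg(3) 2(3)]
    unfolding 3 by (cases "even j"; simp; simp add: field_simps)
qed

text \<open>The bilinear interpolant of \<open>f_C\<close> on the grid of mesh \<open>2\<^sup>-\<^sup>n\<close> changes, when the
  grid is refined once, by the summands 3, 3 and 2 of the recurrence (scaled by \<open>8\<^sup>-\<^sup>n\<^sup>-\<^sup>1\<close>) at the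
  new edge midpoints and cell centres. \<open>bump\<close> interpolates the corner values 0, 3, 3, 2.\<close>

definition bump :: "real \<Rightarrow> real \<Rightarrow> real" where
  "bump s t = 3 * s + 3 * t - 4 * s * t"

definition bump_term :: "nat \<Rightarrow> real \<Rightarrow> real \<Rightarrow> real" where
  "bump_term n x y = bump (tent (2 ^ n * x)) (tent (2 ^ n * y)) / 8 ^ Suc n"

definition bump_sum :: "real \<Rightarrow> real \<Rightarrow> real" where
  "bump_sum x y = (\<Sum>n. bump_term n x y)"

text \<open>The polynomial part interpolates the corner values 0, -1, -1, 2 of \<open>f_int\<close>
  bilinearly. Beyond the unit square the formula need not give \<open>f_C\<close>: at (2, 0) it
  yields -2, whereas \<open>f_int 2 0 = -8\<close>.\<close>

definition square_fun :: "real \<Rightarrow> real \<Rightarrow> real" where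
  "square_fun x y = 4 * x * y - x - y + bump_sum x y"

lemma bump_term_norm: "norm (bump_term n x y) \<le> 6 / 8 ^ Suc n"
proof -
  let ?s = "tent (2 ^ n * x)" let ?t = "tent (2 ^ n * y)"
  have "0 \<le> ?s * ?t" "?s * ?t \<le> ?s" "?s * ?t \<le> ?t"
    using tent_bounds[of "2^n*x"] tent_bounds[of "2^n*y"] by (simp_all add: mult_left_le mult_left_le_one_le)
  then have "\<bar>bump ?s ?t\<bar> \<le> 6" using tent_bounds[of "2^n*x"] tent_bounds[of "2^n*y"]
    unfolding bump_def by linarith
  then show ?thesis unfolding bump_term_def by (simp add: divide_right_mono del: power_Suc)
qed

lemma summable_bump_bound: "summable (\<lambda>n. 6 / 8 ^ Suc n :: real)"
proof -
  have "summable (\<lambda>n. 6/8 * (1/8) ^ n :: real)" by (intro summable_mult summable_geometric) auto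
  then show ?thesis by (simp add: power_one_over)
qed

lemma summable_bump_term: "summable (\<lambda>n. bump_term n x y)"
  by (rule summable_comparison_test'[OF summable_bump_bound bump_term_norm])

lemma continuous_on_square_fun: "continuous_on UNIV (\<lambda>p. square_fun (fst p) (snd p))"
proof -
  have "uniform_limit UNIV (\<lambda>N p. \<Sum>n<N. bump_term n (fst p) (snd p)) (\<lambda>p. bump_sum (fst p) (snd p)) sequentially"
    unfolding bump_sum_def
    by (rule Weierstrass_m_test[where M = "\<lambda>n. 6 / 8 ^ Suc n"]) (rule bump_term_norm summable_bump_bound)+
  moreover have "continuous_on UNIV (\<lambda>p::real\<times>real. \<Sum>n<N. bump_term n (fst p) (snd p))" for N
    unfolding bump_term_def bump_def by (intro continuous_intros) auto
  ultimately have "continuous_on UNIV (\<lambda>p. bump_sum (fst p) (snd p))"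
    by (intro uniform_limit_theorem) auto
  then show ?thesis unfolding square_fun_def by (intro continuous_intros)
qed

text \<open>Halving the point shifts the series by one index, and the integers \<open>d\<close> and
  \<open>e\<close> disappear by periodicity of \<open>tent\<close>. All self-similarity below comes
  from this.\<close>

lemma bump_sum_halve:
  fixes x y :: real and d e :: nat
  shows "bump_sum ((x + d) / 2) ((y + e) / 2)
    = bump (tent ((x + d) / 2)) (tent ((y + e) / 2)) / 8 + bump_sum x y / 8"
proof -
  have *: "tent (2 ^ Suc n * ((x + real d) / 2)) = tent (2 ^ n * x)" for n d and x :: real
    using tent_periodic_nat[of "2^n*x" "2^n*d"] by (simp add: ring_distribs add_divide_distrib)
  have "bump_term (Suc n) ((x + real d) / 2) ((y + e) / 2) = bump_term n x y / 8" for n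
    unfolding bump_term_def * by simp
  note shift = this
  have "bump_sum ((x + d) / 2) ((y + e) / 2) = bump_term 0 ((x + d) / 2) ((y + e) / 2) + (\<Sum>n. bump_term n x y / 8)"
    using suminf_split_head[OF summable_bump_term, of "(x + d) / 2" "(y + e) / 2"]
    unfolding bump_sum_def shift by simp
  then show ?thesis using suminf_divide[OF summable_bump_term, of x y 8]
    unfolding bump_sum_def by (simp add: bump_term_def)
qed

lemma bump_sum_reflect:
  "bump_sum (1 - x) y = bump_sum x y" "bump_sum x (1 - y) = bump_sum x y"
proof -
  have "tent (2 ^ n * (1 - x)) = tent (2 ^ n * x)" for n x
    using tent_periodic_nat[of "- (2^n*x)" "2^n"] by (simp add: algebra_simps)
  then show "bump_sum (1 - x) y = bump_sum x y" "bump_sum x (1 - y) = bump_sum x y"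
    unfolding bump_sum_def bump_term_def by simp_all
qed

text \<open>The tents in the first bump are linear here, and
  \<open>x * y - (x + y) / 2 + bump x y / 8\<close> is exactly an eighth of
  \<open>4 * x * y - x - y\<close>. This is the continuous form of
  \<open>f_int_double\<close>.\<close>

lemma square_fun_halve:
  fixes x y :: real
  assumes "x \<in> {0..1}" "y \<in> {0..1}"
  shows "square_fun (x / 2) (y / 2) = square_fun x y / 8"
  using bump_sum_halve[where x=x and y=y and d=0 and e=0] assms unfolding square_fun_def
  by (simp add: tent_left bump_def field_simps)

lemma square_fun_halve_power:
  assumes "x \<in> {0..1}" "y \<in> {0..1}"
  shows "square_fun (x / 2 ^ k) (y / 2 ^ k) = square_fun x y / 8 ^ k"
proof (induction k)
  case (Suc k)
  have "(1::real) \<le> 2 ^ k" by simp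
  then have "x \<le> 2 ^ k" "y \<le> 2 ^ k" using assms order_trans by (metis atLeastAtMost_iff)+
  then have "x / 2 ^ k \<in> {0..1}" "y / 2 ^ k \<in> {0..1}"
    using assms by simp_all
  from square_fun_halve[OF this] Suc show ?case by (simp add: field_simps)
qed simp

text \<open>The prescribed values at \<open>(0, 1)\<close>, \<open>(1, 0)\<close> and \<open>(1, 1)\<close> themselves satisfy the recurrence, so
  no exceptions are needed below.\<close>

lemma f_int_base:
  "f_int 0 0 = 0" "f_int 0 (Suc 0) = - 1" "f_int (Suc 0) 0 = - 1" "f_int (Suc 0) (Suc 0) = 2"
  by (subst f_int.simps, simp)+

lemma f_int_double: "f_int (2 * a) (2 * b) = 8 * f_int a b"
  by (cases "a = 0 \<and> b = 0") (simp add: f_int_base, subst f_int.simps, auto)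

lemma f_int_odd_even: "f_int (2 * a + 1) (2 * b) = 4 * (f_int a b + f_int (a + 1) b) + 3"
  by (cases "a = 0 \<and> b = 0") (simp add: f_int_base, subst f_int.simps, auto)

lemma f_int_even_odd: "f_int (2 * a) (2 * b + 1) = 4 * (f_int a b + f_int a (b + 1)) + 3"
  by (cases "a = 0 \<and> b = 0") (simp add: f_int_base, subst f_int.simps, auto)

lemma f_int_odd_odd: "f_int (2 * a + 1) (2 * b + 1)
  = 2 * (f_int a b + f_int a (b + 1) + f_int (a + 1) b + f_int (a + 1) (b + 1)) + 2"
  by (cases "a = 0 \<and> b = 0") (simp add: f_int_base, subst f_int.simps, auto)

text \<open>On cells of mesh \<open>1 / 2 ^ m\<close> this is affine in each coordinate, because the
  summands below \<open>m\<close> have kinks on grid lines only.\<close>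

definition interpolant :: "nat \<Rightarrow> real \<Rightarrow> real \<Rightarrow> real" where
  "interpolant m x y = 4 * x * y - x - y + (\<Sum>n<m. bump_term n x y)"

text \<open>The summands from index \<open>m\<close> on vanish at grid points, where
  \<open>tent\<close> is evaluated at integers.\<close>

lemma square_fun_eq_interpolant:
  "square_fun (real a / 2 ^ m) (real b / 2 ^ m) = interpolant m (real a / 2 ^ m) (real b / 2 ^ m)"
proof -
  have "tent (2 ^ n * (real a / 2 ^ m)) = 0" if "n \<ge> m" for n a
  proof -
    have "2 ^ n * (real a / 2 ^ m) = real (2 ^ (n - m) * a)"
      using that by (simp add: power_diff[of "2::real" m n])
    then show ?thesis by (simp only: tent_nat)
  qed
  then have "bump_term n (real a / 2 ^ m) (real b / 2 ^ m) = 0" if "n \<notin> {..<m}" for n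
    using that by (simp add: bump_term_def bump_def)
  then show ?thesis unfolding square_fun_def interpolant_def bump_sum_def
    by (subst suminf_finite[of "{..<m}"]) auto
qed

lemma tent_midpoint_scaled:
  assumes "n < m"
  shows "tent (2 ^ n * (real (2 * a + 1) / 2 ^ Suc m))
    = (tent (2 ^ n * (real a / 2 ^ m)) + tent (2 ^ n * (real (a + 1) / 2 ^ m))) / 2"
proof -
  obtain k where m: "m = n + (k + 1)" using assms by (metis Suc_eq_plus1 add_Suc_right less_imp_Suc_add)
  have "2 ^ n * (z / 2 ^ m) = z / 2 ^ (k + 1)" "2 ^ n * (z / 2 ^ Suc m) = z / 2 ^ (k + 2)" for z :: real
    by (simp_all add: m power_add)
  then show ?thesis by (simp only: tent_midpoint)
qed

lemma bump_mid: "bump ((s + s') / 2) t = (bump s t + bump s' t) / 2"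
  by (simp add: bump_def algebra_simps add_divide_distrib)

lemma interpolant_mid_x:
  "interpolant m (real (2 * a + 1) / 2 ^ Suc m) y
    = (interpolant m (real a / 2 ^ m) y + interpolant m (real (a + 1) / 2 ^ m) y) / 2"
proof -
  have "bump_term n (real (2 * a + 1) / 2 ^ Suc m) y
     = (bump_term n (real a / 2 ^ m) y + bump_term n (real (a + 1) / 2 ^ m) y) / 2" if "n \<in> {..<m}" for n
    using tent_midpoint_scaled[of n m a] that unfolding bump_term_def
    by (simp only: lessThan_iff bump_mid) (simp add: add_divide_distrib)
  then have "(\<Sum>n<m. bump_term n (real (2 * a + 1) / 2 ^ Suc m) y)
    = ((\<Sum>n<m. bump_term n (real a / 2 ^ m) y) + (\<Sum>n<m. bump_term n (real (a + 1) / 2 ^ m) y)) / 2"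
    unfolding sum.distrib[symmetric] sum_divide_distrib by (intro sum.cong) auto
  moreover have "real (2 * a + 1) / 2 ^ Suc m = (real a / 2 ^ m + real (a + 1) / 2 ^ m) / 2"
    by (simp add: field_simps)
  moreover have "4 * ((p + q) / 2) * y - (p + q) / 2 - y + (P + Q) / 2
    = (4 * p * y - p - y + P + (4 * q * y - q - y + Q)) / 2" for p q P Q
    by (simp add: field_simps)
  ultimately show ?thesis unfolding interpolant_def by metis
qed

lemma interpolant_commute: "interpolant m x y = interpolant m y x"
  by (simp add: interpolant_def bump_term_def bump_def algebra_simps)

lemma interpolant_mid_y:
  "interpolant m x (real (2 * b + 1) / 2 ^ Suc m)
    = (interpolant m x (real b / 2 ^ m) + interpolant m x (real (b + 1) / 2 ^ m)) / 2"
  using interpolant_mid_x[of m b x] by (simp only: interpolant_commute)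

text \<open>One refinement takes means over 1, 2 or 4 coarse neighbours and adds the bump 0, 3, 3 or
  2 selected by the parities of \<open>a\<close> and \<open>b\<close>. After multiplication by
  \<open>8 ^ Suc m\<close> the means yield the factors 8, 4 and 2 of the recurrence. The bounds
  leave only the four corners in the base case.\<close>

lemma square_fun_dyadic:
  assumes "a \<le> 2 ^ m" "b \<le> 2 ^ m"
  shows "square_fun (real a / 2 ^ m) (real b / 2 ^ m) = of_int (f_int a b) / 8 ^ m"
  using assms
proof (induction m arbitrary: a b)
  case 0
  then have "a \<in> {0, 1}" "b \<in> {0, 1}" by auto
  then show ?case using square_fun_eq_interpolant[of a 0 b] by (auto simp: interpolant_def f_int_base)
next
  case (Suc m)
  define a' b' where "a' = a div 2" and "b' = b div 2"
  have step: "square_fun (real a / 2 ^ Suc m) (real b / 2 ^ Suc m)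
    = interpolant m (real a / 2 ^ Suc m) (real b / 2 ^ Suc m) + bump (tent (real a / 2)) (tent (real b / 2)) / 8 ^ Suc m"
    unfolding square_fun_eq_interpolant by (simp add: interpolant_def bump_term_def)
  have IH: "interpolant m (real i / 2 ^ m) (real j / 2 ^ m) = of_int (f_int i j) / 8 ^ m"
    if "i \<le> 2 ^ m" "j \<le> 2 ^ m" for i j
    using Suc.IH[OF that] by (simp add: square_fun_eq_interpolant)
  have even: "real (2 * i) / 2 ^ Suc m = real i / 2 ^ m" for i by simp
  have tents: "tent (real (2 * i) / 2) = 0" "tent (real (2 * i + 1) / 2) = 1" for i
    using tent_half_integer[of i] by (simp_all add: add_divide_distrib add.commute)
  consider "a = 2 * a'" "b = 2 * b'" | "a = 2 * a' + 1" "b = 2 * b'"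
    | "a = 2 * a'" "b = 2 * b' + 1" | "a = 2 * a' + 1" "b = 2 * b' + 1"
    unfolding a'_def b'_def by (metis add.commute bot_nat_0.not_eq_extremum div_mod_decomp even_iff_mod_2_eq_zero mult.commute odd_iff_mod_2_eq_one add.right_neutral)
  then show ?case
  proof cases
    case 1
    with Suc.prems have "a' \<le> 2 ^ m" "b' \<le> 2 ^ m" by auto
    then show ?thesis unfolding step unfolding 1 even tents by (simp add: IH f_int_double bump_def)
  next
    case 2
    with Suc.prems have "a' \<le> 2 ^ m" "a' + 1 \<le> 2 ^ m" "b' \<le> 2 ^ m" by auto
    then show ?thesis unfolding step unfolding 2 even tents interpolant_mid_x
      by (simp only: IH f_int_odd_even bump_def) (simp add: field_simps)
  next
    case 3
    with Suc.prems have "a' \<le> 2 ^ m" "b' + 1 \<le> 2 ^ m" "b' \<le> 2 ^ m" by auto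
    then show ?thesis unfolding step unfolding 3 even tents interpolant_mid_y
      by (simp only: IH f_int_even_odd bump_def) (simp add: field_simps)
  next
    case 4
    with Suc.prems have "a' \<le> 2 ^ m" "a' + 1 \<le> 2 ^ m" "b' + 1 \<le> 2 ^ m" "b' \<le> 2 ^ m" by auto
    then show ?thesis unfolding step unfolding 4 even tents interpolant_mid_y interpolant_mid_x
      by (simp only: IH f_int_odd_odd bump_def) (simp add: field_simps)
  qed
qed

section \<open>The function on the quadrant and the self-similarity of the gap\<close>

text \<open>Absolute values extend the function to the whole plane, where continuity can be checked on
  open squares.\<close>

definition quadrant_fun :: "real \<times> real \<Rightarrow> real" where
  "quadrant_fun p = (let k = nat \<lceil>max \<bar>fst p\<bar> \<bar>snd p\<bar>\<rceil> in 8 ^ k * square_fun (\<bar>fst p\<bar> / 2 ^ k) (\<bar>snd p\<bar> / 2 ^ k))"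

text \<open>By \<open>square_fun_halve_power\<close> all sufficiently large scales give the same
  value. Near a given point one exponent therefore serves, which yields continuity.\<close>

lemma quadrant_fun_eq:
  assumes "\<bar>x\<bar> \<le> 2 ^ m" "\<bar>y\<bar> \<le> 2 ^ m"
  shows "quadrant_fun (x, y) = 8 ^ m * square_fun (\<bar>x\<bar> / 2 ^ m) (\<bar>y\<bar> / 2 ^ m)"
proof -
  have step: "8 ^ (k + j) * square_fun (\<bar>x\<bar> / 2 ^ (k + j)) (\<bar>y\<bar> / 2 ^ (k + j)) = 8 ^ k * square_fun (\<bar>x\<bar> / 2 ^ k) (\<bar>y\<bar> / 2 ^ k)"
    if "\<bar>x\<bar> \<le> 2 ^ k" "\<bar>y\<bar> \<le> 2 ^ k" for k j
    using square_fun_halve_power[of "\<bar>x\<bar> / 2 ^ k" "\<bar>y\<bar> / 2 ^ k" j] that by (simp add: power_add)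
  define k where "k = nat \<lceil>max \<bar>x\<bar> \<bar>y\<bar>\<rceil>"
  have "max \<bar>x\<bar> \<bar>y\<bar> \<le> real k" unfolding k_def by (rule real_nat_ceiling_ge)
  also have "\<dots> \<le> 2 ^ k" using of_nat_less_two_power[of k, where 'a = real] by simp
  finally have k: "\<bar>x\<bar> \<le> 2 ^ k" "\<bar>y\<bar> \<le> 2 ^ k" by auto
  have "8 ^ k * square_fun (\<bar>x\<bar> / 2 ^ k) (\<bar>y\<bar> / 2 ^ k) = 8 ^ m * square_fun (\<bar>x\<bar> / 2 ^ m) (\<bar>y\<bar> / 2 ^ m)"
    using step[OF k, of "m - k"] step[OF assms, of "k - m"] by (cases "k \<le> m") simp_all
  then show ?thesis by (simp add: quadrant_fun_def k_def)
qed

lemma continuous_on_quadrant_fun: "continuous_on UNIV quadrant_fun"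
proof -
  define U where "U m = {p :: real \<times> real. \<bar>fst p\<bar> < 2 ^ m \<and> \<bar>snd p\<bar> < 2 ^ m}" for m :: nat
  have open_U: "open (U m)" for m
    unfolding U_def by (intro open_Collect_conj open_Collect_less continuous_intros)
  have "continuous_on (U m) quadrant_fun" for m
  proof -
    have "continuous_on (U m) (\<lambda>p. 8 ^ m * square_fun (fst (\<bar>fst p\<bar> / 2 ^ m, \<bar>snd p\<bar> / 2 ^ m)) (snd (\<bar>fst p\<bar> / 2 ^ m, \<bar>snd p\<bar> / 2 ^ m)))"
      by (intro continuous_intros continuous_on_compose2[OF continuous_on_square_fun]) auto
    then show ?thesis
      by (rule continuous_on_eq) (auto simp: U_def quadrant_fun_eq[of _ m] less_imp_le)
  qed
  moreover have "p \<in> (\<Union>m. U m)" for p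
  proof -
    obtain m where "max \<bar>fst p\<bar> \<bar>snd p\<bar> < 2 ^ m" using real_arch_pow[of 2 "max \<bar>fst p\<bar> \<bar>snd p\<bar>"] by auto
    then show ?thesis by (auto simp: U_def)
  qed
  ultimately show ?thesis using continuous_on_open_UN[of UNIV U quadrant_fun] open_U
    by (metis UNIV_eq_I)
qed

lemma quadrant_fun_dyadic:
  "quadrant_fun (real a / 2 ^ n, real b / 2 ^ n) = of_int (f_int a b) / 8 ^ n"
proof -
  \<comment> \<open>As \<open>a + b < 2 ^ (a + b)\<close>, this \<open>k\<close> is large enough for
    both \<open>quadrant_fun_eq\<close> and \<open>square_fun_dyadic\<close>.\<close>
  define k where "k = a + b"
  have "a + b \<le> 2 ^ k" unfolding k_def using less_exp by (rule less_imp_le)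
  then have "a \<le> 2 ^ k" "b \<le> 2 ^ k" by auto
  moreover have "(2::nat) ^ k \<le> 2 ^ (n + k)" by simp
  ultimately have ab: "a \<le> 2 ^ (n + k)" "b \<le> 2 ^ (n + k)" by (meson order_trans)+
  have "real a \<le> 2 ^ (n + k)" "real b \<le> 2 ^ (n + k)"
    using ab[THEN of_nat_mono, where ?'a = real] by simp_all
  then have le: "\<bar>real a / 2 ^ n\<bar> \<le> 2 ^ k" "\<bar>real b / 2 ^ n\<bar> \<le> 2 ^ k"
    by (simp_all add: field_simps power_add)
  have "quadrant_fun (real a / 2 ^ n, real b / 2 ^ n) = 8 ^ k * square_fun (real a / 2 ^ (n + k)) (real b / 2 ^ (n + k))"
    unfolding quadrant_fun_eq[OF le] by (simp add: power_add)
  then show ?thesis unfolding square_fun_dyadic[OF ab] by (simp add: power_add)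
qed

section \<open>Density of the dyadic points and uniqueness of the extension\<close>

lemma tendsto_floor_dyadic:
  "(\<lambda>n. real_of_int \<lfloor>2 ^ n * x\<rfloor> / 2 ^ n) \<longlonglongrightarrow> x"
proof (rule tendsto_sandwich)
  show "(\<lambda>n. x - (1/2) ^ n) \<longlonglongrightarrow> x"
    by (rule tendsto_eq_intros LIMSEQ_power_zero | simp)+
  show "\<forall>\<^sub>F n in sequentially. x - (1/2) ^ n \<le> real_of_int \<lfloor>2 ^ n * x\<rfloor> / 2 ^ n"
  proof (intro always_eventually allI)
    fix n
    have "2 ^ n * x - 1 \<le> real_of_int \<lfloor>2 ^ n * x\<rfloor>" by linarith
    then have "(2 ^ n * x - 1) / 2 ^ n \<le> real_of_int \<lfloor>2 ^ n * x\<rfloor> / 2 ^ n"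
      by (rule divide_right_mono) simp
    then show "x - (1/2) ^ n \<le> real_of_int \<lfloor>2 ^ n * x\<rfloor> / 2 ^ n"
      by (simp add: diff_divide_distrib power_one_over)
  qed
  show "\<forall>\<^sub>F n in sequentially. real_of_int \<lfloor>2 ^ n * x\<rfloor> / 2 ^ n \<le> x"
  proof (intro always_eventually allI)
    fix n
    have "real_of_int \<lfloor>2 ^ n * x\<rfloor> \<le> 2 ^ n * x" by linarith
    then show "real_of_int \<lfloor>2 ^ n * x\<rfloor> / 2 ^ n \<le> x" by (simp add: field_simps)
  qed
qed simp

lemma continuous_on_quadrant_eqI:
  fixes g h :: "real \<times> real \<Rightarrow> real"
  assumes g: "continuous_on quadrant g" and h: "continuous_on quadrant h"
    and dyadic: "\<And>a b n :: nat. g (real a / 2 ^ n, real b / 2 ^ n) = h (real a / 2 ^ n, real b / 2 ^ n)"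
    and p: "p \<in> quadrant"
  shows "g p = h p"
proof -
  obtain x y where xy: "p = (x, y)" "0 \<le> x" "0 \<le> y" using p by (auto simp: quadrant_def)
  \<comment> \<open>The floors are non-negative in the quadrant, so \<open>nat\<close> loses nothing
    and \<open>dyadic\<close> covers these approximants.\<close>
  define q where "q n = (real (nat \<lfloor>2 ^ n * x\<rfloor>) / 2 ^ n, real (nat \<lfloor>2 ^ n * y\<rfloor>) / 2 ^ n)" for n :: nat
  have "q = (\<lambda>n. (real_of_int \<lfloor>2 ^ n * x\<rfloor> / 2 ^ n, real_of_int \<lfloor>2 ^ n * y\<rfloor> / 2 ^ n))"
    using xy by (simp add: q_def fun_eq_iff)
  then have q: "q \<longlonglongrightarrow> p" unfolding xy(1) by (simp add: tendsto_Pair tendsto_floor_dyadic)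
  have q_in: "q n \<in> quadrant" for n by (simp add: q_def quadrant_def)
  have "(\<lambda>n. g (q n)) \<longlonglongrightarrow> g p" "(\<lambda>n. h (q n)) \<longlonglongrightarrow> h p"
    using continuous_on_tendsto_compose[OF g q p] continuous_on_tendsto_compose[OF h q p] q_in by auto
  moreover have "g (q n) = h (q n)" for n unfolding q_def by (rule dyadic)
  ultimately show ?thesis by (simp add: LIMSEQ_unique)
qed

text \<open>This resolves the definite description: \<open>quadrant_fun\<close> supplies existence,
  density of the dyadic points and extensionality supply uniqueness.\<close>

lemma f_C_eq_restrict: "f_C = restrict quadrant_fun quadrant"
  unfolding f_C_def
proof (rule the_equality, intro conjI allI)
  have in_quadrant: "(real a / 2 ^ n, real b / 2 ^ n) \<in> quadrant" for a b n :: nat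
    by (simp add: quadrant_def)
  have cont: "continuous_on quadrant (restrict quadrant_fun quadrant)"
    by (rule continuous_on_eq[OF continuous_on_subset[OF continuous_on_quadrant_fun]]) auto
  then show "continuous_on quadrant (restrict quadrant_fun quadrant)" .
  show dyadic: "restrict quadrant_fun quadrant (real a / 2 ^ n, real b / 2 ^ n) = of_int (f_int a b) / 8 ^ n" for a b n
    by (simp add: in_quadrant quadrant_fun_dyadic)
  fix g :: "real \<times> real \<Rightarrow> real"
  assume g: "continuous_on quadrant g
     \<and> (\<forall>a b n :: nat. g (real a / 2 ^ n, real b / 2 ^ n) = of_int (f_int a b) / 8 ^ n)
     \<and> g \<in> extensional quadrant"
  show "g = restrict quadrant_fun quadrant"
  proof (rule extensionalityI)
    show "g x = restrict quadrant_fun quadrant x" if "x \<in> quadrant" for x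
      using continuous_on_quadrant_eqI[OF _ cont _ that] g dyadic by simp
  qed (use g in auto)
qed simp

lemma f_C_eq_square_fun:
  assumes "x \<in> {0..1}" "y \<in> {0..1}"
  shows "f_C (x, y) = square_fun x y"
  using assms quadrant_fun_eq[of x 0 y] by (simp add: f_C_eq_restrict quadrant_def)

lemma continuous_on_f_C: "continuous_on unit_square f_C"
  by (rule continuous_on_eq[OF continuous_on_subset[OF continuous_on_square_fun]])
     (auto simp: unit_square_def f_C_eq_square_fun)

text \<open>Written with \<open>square_fun\<close> instead of \<open>f_C\<close>, so that it is
  continuous on the whole space and its symmetries hold without range conditions.\<close>

definition gap :: "real \<Rightarrow> real \<Rightarrow> real \<Rightarrow> real" where
  "gap x y z = 8 * x * y * z - (square_fun x y + square_fun y z + square_fun z x)"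

lemma gap_eq_F_C:
  "x \<in> {0..1} \<Longrightarrow> y \<in> {0..1} \<Longrightarrow> z \<in> {0..1} \<Longrightarrow> gap x y z = 8 * x * y * z - F_C x y z"
  by (simp add: gap_def F_C_def f_C_eq_square_fun)

lemma gap_rotate: "gap y z x = gap x y z"
  by (simp add: gap_def)

text \<open>In the coordinates \<open>X = 2 * x - 1\<close> etc., the part of \<open>gap\<close> without \<open>bump_sum\<close> is \<open>1 + X * Y * Z\<close>;
  this explains the invariance under reflecting two coordinates.\<close>

lemma gap_reflect: "gap x (1 - y) (1 - z) = gap x y z"
  by (simp add: gap_def square_fun_def bump_sum_reflect algebra_simps)

text \<open>\<open>bump_sum x y\<close> is kept separate because for general digits the terms
  recombine to values of \<open>square_fun\<close> only after summation over the three
  pairs.\<close>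

lemma square_fun_child:
  fixes x y :: real and d e :: nat
  assumes "x \<in> {0..1}" "y \<in> {0..1}" "d \<in> {0, 1}" "e \<in> {0, 1}"
  shows "square_fun ((x + d) / 2) ((y + e) / 2) = (x + d) * (y + e) - (x + d + y + e) / 2
    + bump (if d = 0 then x else 1 - x) (if e = 0 then y else 1 - y) / 8 + bump_sum x y / 8"
proof -
  have "tent ((t + c) / 2) = (if c = 0 then t else 1 - t)" if "t \<in> {0..1}" "c \<in> {0, 1}" for t :: real and c :: nat
    using that tent_left[of "t / 2"] tent_right[of "(t + 1) / 2"] by (auto simp: field_simps)
  then show ?thesis using bump_sum_halve[of x d y e] assms
    by (simp add: square_fun_def field_simps)
qed

text \<open>For digits 0, 0, 0 every term of \<open>gap\<close> scales by 1/8, and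
  \<open>gap_reflect\<close> carries this to the other even subcubes. The proof computes the four
  cases directly.\<close>

lemma gap_even:
  fixes x y z :: real and a b c :: nat
  assumes "x \<in> {0..1}" "y \<in> {0..1}" "z \<in> {0..1}" "a \<in> {0, 1}" "b \<in> {0, 1}" "c \<in> {0, 1}" "even (a + b + c)"
  shows "gap ((x + real a) / 2) ((y + real b) / 2) ((z + real c) / 2) = gap x y z / 8"
  using assms(4-7) unfolding gap_def
  by (auto simp: square_fun_child[OF assms(1,2)] square_fun_child[OF assms(2,3)] square_fun_child[OF assms(3,1)] simp del: of_nat_0 of_nat_1 of_nat_Suc)
     (simp_all add: square_fun_def bump_def algebra_simps add_divide_distrib)

text \<open>The only odd subcube that is computed; reflections and rotations lead from it to the
  other three.\<close>

lemma gap_111: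
  assumes "x \<in> {0..1}" "y \<in> {0..1}" "z \<in> {0..1}"
  shows "gap ((x + 1) / 2) ((y + 1) / 2) ((z + 1) / 2) = gap (1 - x) (1 - y) (1 - z) / 8 + 2 * x * y * z"
  using square_fun_child[OF assms(1,2), of 1 1] square_fun_child[OF assms(2,3), of 1 1] square_fun_child[OF assms(3,1), of 1 1]
  unfolding gap_def
  by (simp add: square_fun_def bump_sum_reflect bump_def field_simps)

text \<open>Reflection exchanges the first digits 0 and 1 of the last two coordinates, since
  \<open>1 - y / 2 = ((1 - y) + 1) / 2\<close>; this reduces to \<open>gap_111\<close>.\<close>

lemma gap_100:
  assumes "x \<in> {0..1}" "y \<in> {0..1}" "z \<in> {0..1}"
  shows "gap ((x + 1) / 2) (y / 2) (z / 2) = gap (1 - x) y z / 8 + 2 * x * (1 - y) * (1 - z)"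
  using gap_111[of x "1 - y" "1 - z"] gap_reflect[of "(x + 1) / 2" "y / 2" "z / 2"] assms
  by (simp add: field_simps)

section \<open>Descent to subcubes and the sign of the gap\<close>

lemma unit_interval_child:
  assumes "x \<in> {0..1::real}"
  obtains t and c :: nat where "t \<in> {0..1}" "c \<in> {0, 1}" "x = (t + real c) / 2"
  using assms that[of "2 * x" 0] that[of "2 * x - 1" 1] by (cases "x \<le> 1/2") auto

text \<open>A relation rather than a function: points with a coordinate 1/2 may lie in several even
  subcubes, and interior points of odd subcubes lie in none.\<close>

definition even_child :: "real \<Rightarrow> real \<Rightarrow> real \<Rightarrow> real \<Rightarrow> real \<Rightarrow> real \<Rightarrow> nat \<Rightarrow> nat \<Rightarrow> nat \<Rightarrow> bool" where
  "even_child x y z x' y' z' a b c \<longleftrightarrow> x' \<in> {0..1} \<and> y' \<in> {0..1} \<and> z' \<in> {0..1}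
     \<and> a \<in> {0, 1} \<and> b \<in> {0, 1} \<and> c \<in> {0, 1} \<and> even (a + b + c)
     \<and> x = (x' + real a) / 2 \<and> y = (y' + real b) / 2 \<and> z = (z' + real c) / 2"

lemma even_child_rotate: "even_child y z x y' z' x' b c a \<longleftrightarrow> even_child x y z x' y' z' a b c"
  unfolding even_child_def by (auto simp: ac_simps)

text \<open>Where the extra summand \<open>2 * x * y * z\<close> of \<open>gap_111\<close> vanishes, the point lies on a face shared
  with a subcube of even parity.\<close>

lemma child_111:
  assumes "x \<in> {0..1}" "y \<in> {0..1}" "z \<in> {0..1}"
  shows "(\<exists>x' y' z' a b c. even_child ((x + 1) / 2) ((y + 1) / 2) ((z + 1) / 2) x' y' z' a b c)
    \<or> gap ((x + 1) / 2) ((y + 1) / 2) ((z + 1) / 2) > gap (1 - x) (1 - y) (1 - z) / 8"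
proof -
  \<comment> \<open>The first coordinate is 1/2, and \<open>(0 + 1) / 2 = (1 + 0) / 2\<close> lets
    its digit 1 be exchanged for 0, which flips the parity.\<close>
  have "even_child ((x + 1) / 2) ((y + 1) / 2) ((z + 1) / 2) 1 y z 0 1 1" if "x = 0"
    using assms that by (simp add: even_child_def)
  moreover have "even_child ((x + 1) / 2) ((y + 1) / 2) ((z + 1) / 2) x 1 z 1 0 1" if "y = 0"
    using assms that by (simp add: even_child_def)
  moreover have "even_child ((x + 1) / 2) ((y + 1) / 2) ((z + 1) / 2) x y 1 1 1 0" if "z = 0"
    using assms that by (simp add: even_child_def)
  moreover have "x * y * z > 0" if "x \<noteq> 0" "y \<noteq> 0" "z \<noteq> 0"
    using that assms by simp
  ultimately show ?thesis using gap_111[OF assms] by fastforce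
qed

lemma child_100:
  assumes "x \<in> {0..1}" "y \<in> {0..1}" "z \<in> {0..1}"
  shows "(\<exists>x' y' z' a b c. even_child ((x + 1) / 2) (y / 2) (z / 2) x' y' z' a b c)
    \<or> gap ((x + 1) / 2) (y / 2) (z / 2) > gap (1 - x) y z / 8"
proof -
  have "even_child ((x + 1) / 2) (y / 2) (z / 2) 1 y z 0 0 0" if "x = 0"
    using assms that by (simp add: even_child_def)
  moreover have "even_child ((x + 1) / 2) (y / 2) (z / 2) x 0 z 1 1 0" if "y = 1"
    using assms that by (simp add: even_child_def)
  moreover have "even_child ((x + 1) / 2) (y / 2) (z / 2) x y 0 1 0 1" if "z = 1"
    using assms that by (simp add: even_child_def)
  moreover have "x * (1 - y) * (1 - z) > 0" if "x \<noteq> 0" "y \<noteq> 1" "z \<noteq> 1"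
    using that assms by simp
  ultimately show ?thesis using gap_100[OF assms] by fastforce
qed

text \<open>Strictness in the second alternative serves the equality case: at a zero of
  \<open>gap\<close> it would force a negative value elsewhere in the cube.\<close>

lemma gap_child:
  assumes "x \<in> {0..1}" "y \<in> {0..1}" "z \<in> {0..1}"
  shows "(\<exists>x' y' z' a b c. even_child x y z x' y' z' a b c)
    \<or> (\<exists>x'\<in>{0..1}. \<exists>y'\<in>{0..1}. \<exists>z'\<in>{0..1}. gap x y z > gap x' y' z' / 8)"
proof -
  obtain t a where x: "t \<in> {0..1}" "a \<in> {0, 1}" "x = (t + real a) / 2" using unit_interval_child[OF assms(1)] .
  obtain u b where y: "u \<in> {0..1}" "b \<in> {0, 1}" "y = (u + real b) / 2" using unit_interval_child[OF assms(2)] .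
  obtain v c where z: "v \<in> {0..1}" "c \<in> {0, 1}" "z = (v + real c) / 2" using unit_interval_child[OF assms(3)] .
  have refl: "1 - t \<in> {0..1}" "1 - u \<in> {0..1}" "1 - v \<in> {0..1}" using x y z by auto
  consider "even (a + b + c)" | "a = 1" "b = 1" "c = 1" | "a = 1" "b = 0" "c = 0" | "a = 0" "b = 1" "c = 0" | "a = 0" "b = 0" "c = 1"
    using x(2) y(2) z(2) by auto
  then show ?thesis
  proof cases
    case 1
    then have "even_child x y z t u v a b c" using x y z by (simp add: even_child_def)
    then show ?thesis by blast
  next
    case 2
    have e: "x = (t + 1) / 2" "y = (u + 1) / 2" "z = (v + 1) / 2" using x y z 2 by simp_all
    show ?thesis using child_111[OF x(1) y(1) z(1)] refl unfolding e by blast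
  next
    case 3
    have e: "x = (t + 1) / 2" "y = u / 2" "z = v / 2" using x y z 3 by simp_all
    show ?thesis using child_100[OF x(1) y(1) z(1)] refl y(1) z(1) unfolding e by blast
  next
    case 4
    have e: "x = t / 2" "y = (u + 1) / 2" "z = v / 2" using x y z 4 by simp_all
    \<comment> \<open>Rotation moves the digit 1 to the first place, where \<open>child_100\<close>
      applies.\<close>
    have "gap y z x = gap x y z" "gap (1 - u) v t = gap t (1 - u) v" by (simp_all only: gap_rotate)
    then show ?thesis using child_100[OF y(1) z(1) x(1), folded e] refl x(1) z(1) even_child_rotate[of y z x]
      by metis
  next
    case 5
    have e: "x = t / 2" "y = u / 2" "z = (v + 1) / 2" using x y z 5 by simp_all
    have "gap z x y = gap x y z" "gap (1 - v) t u = gap t u (1 - v)" by (simp_all only: gap_rotate)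
    then show ?thesis using child_100[OF z(1) x(1) y(1), folded e] refl x(1) y(1) even_child_rotate[of x y z]
      by metis
  qed
qed

lemma gap_even_child: "even_child x y z x' y' z' a b c \<Longrightarrow> gap x y z = gap x' y' z' / 8"
  unfolding even_child_def using gap_even[of x' y' z' a b c] by blast

lemma continuous_on_gap: "continuous_on UNIV (\<lambda>(x, y, z). gap x y z)"
proof -
  have *: "continuous_on UNIV (\<lambda>p. square_fun (g p) (h p))"
    if "continuous_on UNIV g" "continuous_on UNIV h" for g h :: "real \<times> real \<times> real \<Rightarrow> real"
    using continuous_on_compose2[OF continuous_on_square_fun continuous_on_Pair[OF that]] by auto
  show ?thesis unfolding gap_def case_prod_unfold
    by (intro continuous_intros *)
qed

lemma gap_bounded:
  obtains M where "\<And>x y z. x \<in> {0..1} \<Longrightarrow> y \<in> {0..1} \<Longrightarrow> z \<in> {0..1} \<Longrightarrow> \<bar>gap x y z\<bar> \<le> M"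
proof -
  have "compact ((\<lambda>(x, y, z). gap x y z) ` ({0..1} \<times> {0..1} \<times> {0..1}))"
    by (intro compact_continuous_image continuous_on_subset[OF continuous_on_gap] compact_Times) auto
  then obtain M where "\<forall>v \<in> (\<lambda>(x, y, z). gap x y z) ` ({0..1} \<times> {0..1} \<times> {0..1}). norm v \<le> M"
    using compact_imp_bounded bounded_iff by blast
  then show ?thesis using that by force
qed

lemma gap_nonneg:
  assumes "x \<in> {0..1}" "y \<in> {0..1}" "z \<in> {0..1}"
  shows "0 \<le> gap x y z"
proof -
  obtain M where M: "\<bar>gap x y z\<bar> \<le> M" if "x \<in> {0..1}" "y \<in> {0..1}" "z \<in> {0..1}" for x y z
    using gap_bounded by blast
  \<comment> \<open>The bound from compactness improves by the factor 1/8 at each level, uniformly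
    over the cube.\<close>
  have lower: "- M / 8 ^ n \<le> gap x y z" if "x \<in> {0..1}" "y \<in> {0..1}" "z \<in> {0..1}" for x y z n
    using that
  proof (induction n arbitrary: x y z)
    case 0
    then show ?case using M[OF 0] by (simp add: abs_le_iff)
  next
    case (Suc n)
    obtain x' y' z' where "x' \<in> {0..1}" "y' \<in> {0..1}" "z' \<in> {0..1}" "gap x' y' z' / 8 \<le> gap x y z"
      using gap_child[OF Suc.prems]
    proof (elim disjE exE bexE)
      fix x' y' z' a b c assume "even_child x y z x' y' z' a b c"
      then show ?thesis using that[of x' y' z'] gap_even_child[of x y z x' y' z' a b c]
        unfolding even_child_def by linarith
    next
      fix x' y' z' :: real
      assume "x' \<in> {0..1}" "y' \<in> {0..1}" "z' \<in> {0..1}" "gap x' y' z' / 8 < gap x y z"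
      then show ?thesis using that[of x' y' z'] by linarith
    qed
    then have le: "- M / 8 ^ n \<le> gap x' y' z'" "gap x' y' z' / 8 \<le> gap x y z" using Suc.IH by blast+
    have "- M / 8 ^ n / 8 \<le> gap x' y' z' / 8" using le(1) by (rule divide_right_mono) simp
    then have "- M / 8 ^ n / 8 \<le> gap x y z" using le(2) by (rule order_trans)
    then show ?case by (simp add: mult.commute)
  qed
  have "(\<lambda>n. - M * (1/8) ^ n) \<longlonglongrightarrow> - M * 0"
    by (intro tendsto_intros LIMSEQ_power_zero) simp
  then have "(\<lambda>n. - M / 8 ^ n) \<longlonglongrightarrow> 0" by (simp add: power_one_over)
  then show ?thesis by (rule LIMSEQ_le_const2) (use lower[OF assms] in auto)
qed

lemma gap_zero_child:
  assumes "x \<in> {0..1}" "y \<in> {0..1}" "z \<in> {0..1}" "gap x y z = 0"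
  obtains x' y' z' a b c where "even_child x y z x' y' z' a b c" "gap x' y' z' = 0"
  using gap_child[OF assms(1-3)]
proof (elim disjE exE bexE)
  fix x' y' z' a b c assume "even_child x y z x' y' z' a b c"
  then show ?thesis using that gap_even_child[of x y z x' y' z' a b c] assms(4) by auto
next
  fix x' y' z' :: real
  assume "x' \<in> {0..1}" "y' \<in> {0..1}" "z' \<in> {0..1}" "gap x' y' z' / 8 < gap x y z"
  then show ?thesis using gap_nonneg[of x' y' z'] assms(4) by simp
qed

section \<open>Binary digits and the zeros of the gap\<close>

lemma dyadic_rational_child_iff: "dyadic_rational ((x + real c) / 2) \<longleftrightarrow> dyadic_rational x"
proof
  assume "dyadic_rational x"
  then obtain k n where "x = real_of_int k / 2 ^ n" by (auto simp: dyadic_rational_def)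
  then have "(x + real c) / 2 = real_of_int (k + int c * 2 ^ n) / 2 ^ Suc n" by (simp add: field_simps)
  then show "dyadic_rational ((x + real c) / 2)" unfolding dyadic_rational_def by blast
next
  assume "dyadic_rational ((x + real c) / 2)"
  then obtain k n where "(x + real c) / 2 = real_of_int k / 2 ^ n" by (auto simp: dyadic_rational_def)
  then have "x = real_of_int (2 * k - int c * 2 ^ n) / 2 ^ n" by (simp add: field_simps)
  then show "dyadic_rational x" unfolding dyadic_rational_def by blast
qed

lemma binary_expansion_digit: "binary_expansion x d \<Longrightarrow> d i \<in> {0, 1}"
  by (simp add: binary_expansion_def)

lemma binary_expansion_sums: "binary_expansion x d \<Longrightarrow> (\<lambda>i. real (d i) / 2 ^ Suc i) sums x"
  by (simp add: binary_expansion_def)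

lemma binary_expansion_bounds:
  assumes "binary_expansion x d"
  shows "x \<in> {0..1}"
proof -
  note d = binary_expansion_digit[OF assms] and sums = binary_expansion_sums[OF assms]
  have "real (d i) / 2 ^ Suc i \<le> (1/2) ^ Suc i" for i
    using d[of i] by (auto simp: power_one_over)
  then have "x \<le> 1" using sums_le[OF _ sums power_half_series] by simp
  moreover have "0 \<le> x" using sums_le[OF _ sums_zero sums] by simp
  ultimately show ?thesis by simp
qed

lemma binary_expansion_lt_1:
  assumes "binary_expansion x d" "d k = 0"
  shows "x < 1"
proof -
  note d = binary_expansion_digit[OF assms(1)] and sums = binary_expansion_sums[OF assms(1)]
  let ?g = "\<lambda>i. (1/2) ^ Suc i - real (d i) / 2 ^ Suc i"
  have g: "?g sums (1 - x)" by (rule sums_diff[OF power_half_series sums])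
  have "0 \<le> ?g i" for i using d[of i] by (auto simp: power_one_over)
  moreover have "0 < ?g k" using assms(2) by simp
  ultimately have "0 < suminf ?g" using suminf_pos2[OF sums_summable[OF g]] by blast
  then show ?thesis using sums_unique[OF g] by simp
qed

lemma binary_expansion_tail:
  assumes "binary_expansion x d"
  shows "binary_expansion (2 * x - real (d 0)) (\<lambda>i. d (Suc i))"
  unfolding binary_expansion_def
proof (intro conjI allI impI)
  note d = binary_expansion_digit[OF assms] and sums = binary_expansion_sums[OF assms]
  show "d (Suc i) \<in> {0, 1}" for i by (rule d)
  have "(\<lambda>i. real (d (Suc i)) / 2 ^ Suc (Suc i)) sums (x - real (d 0) / 2)"
    using sums unfolding sums_Suc_iff[of "\<lambda>i. real (d i) / 2 ^ Suc i"] by simp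
  from sums_mult[OF this, of 2] show "(\<lambda>i. real (d (Suc i)) / 2 ^ Suc i) sums (2 * x - real (d 0))"
    by (simp add: algebra_simps)
  assume *: "dyadic_rational (2 * x - real (d 0)) \<and> 2 * x - real (d 0) < 1"
  then have "dyadic_rational x" "x < 1"
    using dyadic_rational_child_iff[of "2 * x - real (d 0)" "d 0"] d[of 0] by auto
  then have "finite {i. d i = 1}" using assms by (simp add: binary_expansion_def)
  then have "finite (Suc -` {i. d i = 1})" by (rule finite_vimageI) simp
  then show "finite {i. d (Suc i) = 1}" by (simp add: vimage_def)
qed

text \<open>For \<open>x = 1\<close> and \<open>c = 0\<close> the digits 0, 1, 1, ... would
  represent 1/2 with infinitely many ones, which is not the admissible expansion; hence
  \<open>x < 1\<close>.\<close>

lemma binary_expansion_child: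
  assumes "binary_expansion x d" "c \<in> {0, 1}" "x < 1"
  shows "binary_expansion ((x + real c) / 2) (case_nat c d)"
  unfolding binary_expansion_def
proof (intro conjI allI impI)
  note d = binary_expansion_digit[OF assms(1)] and sums = binary_expansion_sums[OF assms(1)]
  show "case_nat c d i \<in> {0, 1}" for i using d assms(2) by (auto split: nat.split)
  have "(\<lambda>i. real (d i) / 2 ^ Suc (Suc i)) sums (x / 2)"
    using sums_divide[OF sums, of 2] by (simp add: mult.commute)
  then show "(\<lambda>i. real (case_nat c d i) / 2 ^ Suc i) sums ((x + real c) / 2)"
    using sums_Suc_iff[of "\<lambda>i. real (case_nat c d i) / 2 ^ Suc i" "x / 2"] by (simp add: add_divide_distrib)
  assume "dyadic_rational ((x + real c) / 2) \<and> (x + real c) / 2 < 1"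
  then have "finite {i. d i = 1}" using assms by (simp add: binary_expansion_def dyadic_rational_child_iff)
  moreover have "{i. case_nat c d i = 1} \<subseteq> insert 0 (Suc ` {i. d i = 1})"
  proof
    fix i assume "i \<in> {i. case_nat c d i = 1}"
    then show "i \<in> insert 0 (Suc ` {i. d i = 1})" by (cases i) auto
  qed
  ultimately show "finite {i. case_nat c d i = 1}" using finite_subset by blast
qed

lemma binary_expansion_first_digit:
  assumes "binary_expansion x d"
  shows "d 0 = (if 1/2 \<le> x then 1 else 0)"
proof (cases "d 0 = 0")
  case True
  have tail: "binary_expansion (2 * x) (\<lambda>i. d (Suc i))" using binary_expansion_tail[OF assms] True by simp
  \<comment> \<open>The tail sums to at most 1, so only 1/2 has to be excluded. Its expansion has
    finitely many ones, so a zero occurs in the tail, and the sum \<open>2 * x\<close> of the tail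
    is below 1.\<close>
  have "x < 1/2"
  proof (rule ccontr)
    assume "\<not> x < 1/2"
    then have x: "x = 1/2" using binary_expansion_bounds[OF tail] by simp
    have "x = real_of_int 1 / 2 ^ 1" by (simp add: x)
    then have "dyadic_rational x" unfolding dyadic_rational_def by blast
    then have "finite {i. d i = 1}" using assms x by (simp add: binary_expansion_def)
    then have "finite (Suc -` {i. d i = 1})" by (rule finite_vimageI) simp
    then obtain i where "d (Suc i) \<noteq> 1" using infinite_UNIV_nat
      by (metis (mono_tags, lifting) UNIV_I ex_new_if_finite vimageI mem_Collect_eq)
    then have "d (Suc i) = 0" using binary_expansion_digit[OF assms, of "Suc i"] by auto
    from binary_expansion_lt_1[OF tail this] x show False by simp
  qed
  then show ?thesis using True by simp
next
  case False
  then have "d 0 = 1" using binary_expansion_digit[OF assms, of 0] by auto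
  then show ?thesis using binary_expansion_bounds[OF binary_expansion_tail[OF assms]] by simp
qed

lemma binary_expansion_unique:
  assumes "binary_expansion x d" "binary_expansion x d'"
  shows "d = d'"
proof
  fix i
  show "d i = d' i" using assms
  proof (induction i arbitrary: x d d')
    case 0
    then show ?case by (simp add: binary_expansion_first_digit)
  next
    case (Suc i)
    have "d 0 = d' 0" using Suc.prems by (simp add: binary_expansion_first_digit)
    then show ?case
      using Suc.IH[OF binary_expansion_tail[OF Suc.prems(1)]] binary_expansion_tail[OF Suc.prems(2)] by simp
  qed
qed

lemma binary_expansion_exists:
  assumes "x \<in> {0..1}"
  shows "\<exists>d. binary_expansion x d"
proof (cases "x = 1")
  case True
  \<comment> \<open>The floor digits used in the other case would all be 0 at
    \<open>x = 1\<close>.\<close>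
  have "(\<lambda>i. real 1 / 2 ^ Suc i) sums x" using power_half_series True by (simp add: power_one_over)
  then have "binary_expansion x (\<lambda>_. 1)" using True by (simp add: binary_expansion_def)
  then show ?thesis by blast
next
  case False
  then have x: "0 \<le> x" "x < 1" using assms by auto
  define d where "d i = nat (\<lfloor>2 ^ Suc i * x\<rfloor> mod 2)" for i
  have d: "real (d i) = real_of_int (\<lfloor>2 ^ Suc i * x\<rfloor> mod 2)" for i
    by (simp add: d_def)
  \<comment> \<open>The partial sums are the truncations of \<open>x\<close>, so
    \<open>tendsto_floor_dyadic\<close> gives convergence.\<close>
  have partial: "(\<Sum>i<n. real (d i) / 2 ^ Suc i) = real_of_int \<lfloor>2 ^ n * x\<rfloor> / 2 ^ n" for n
  proof (induction n)
    case 0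
    have "\<lfloor>x\<rfloor> = 0" using x by (simp add: floor_eq_iff)
    then show ?case by simp
  next
    case (Suc n)
    have "\<lfloor>2 ^ n * x\<rfloor> = \<lfloor>2 ^ Suc n * x\<rfloor> div 2"
      using floor_divide_real_eq_div[of 2 "2 ^ Suc n * x"] by simp
    then have "\<lfloor>2 ^ Suc n * x\<rfloor> = 2 * \<lfloor>2 ^ n * x\<rfloor> + \<lfloor>2 ^ Suc n * x\<rfloor> mod 2"
      by (metis mult_div_mod_eq)
    then have "real_of_int \<lfloor>2 ^ Suc n * x\<rfloor> = 2 * real_of_int \<lfloor>2 ^ n * x\<rfloor> + real (d n)"
      unfolding d by (metis of_int_add of_int_mult of_int_numeral)
    then show ?case using Suc by (simp add: field_simps)
  qed
  have "binary_expansion x d"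
    unfolding binary_expansion_def
  proof (intro conjI allI impI)
    show "d i \<in> {0, 1}" for i unfolding d_def by auto
    show "(\<lambda>i. real (d i) / 2 ^ Suc i) sums x"
      unfolding sums_def partial by (rule tendsto_floor_dyadic)
    assume "dyadic_rational x \<and> x < 1"
    then obtain k n where k: "x = real_of_int k / 2 ^ n" by (auto simp: dyadic_rational_def)
    have "d i = 0" if "n \<le> i" for i
    proof -
      have "2 ^ Suc i * x = real_of_int (2 * (k * 2 ^ (i - n)))"
        using that by (simp add: k power_diff[of "2::real" n i])
      then have "\<lfloor>2 ^ Suc i * x\<rfloor> = 2 * (k * 2 ^ (i - n))" by (simp only: floor_of_int)
      then show ?thesis by (simp add: d_def)
    qed
    then have "{i. d i = 1} \<subseteq> {..<n}" by (metis (mono_tags, lifting) lessThan_iff mem_Collect_eq not_le subsetI zero_neq_one)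
    then show "finite {i. d i = 1}" using finite_subset by blast
  qed
  then show ?thesis by blast
qed

lemma binary_digit_eqI: "binary_expansion x d \<Longrightarrow> binary_digit x = d"
  unfolding binary_digit_def using binary_expansion_unique by blast

lemma binary_expansion_binary_digit: "x \<in> {0..1} \<Longrightarrow> binary_expansion x (binary_digit x)"
  using binary_expansion_exists binary_digit_eqI by blast

section \<open>Zeros of the gap as limits of digitwise zero sums\<close>

lemma gap_zero_of_digits:
  assumes "binary_expansion x d" "binary_expansion y e" "binary_expansion z f"
    and even: "\<And>i. even (d i + e i + f i)"
  shows "gap x y z = 0"
proof -
  obtain M where M: "\<bar>gap x y z\<bar> \<le> M" if "x \<in> {0..1}" "y \<in> {0..1}" "z \<in> {0..1}" for x y z
    using gap_bounded by blast
  \<comment> \<open>Dropping the first digits blows an even subcube up to the whole cube, so each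
    position gains a factor 1/8.\<close>
  have "\<bar>gap x y z\<bar> \<le> M / 8 ^ n" for n
    using assms
  proof (induction n arbitrary: x y z d e f)
    case 0
    then show ?case using M binary_expansion_bounds by simp
  next
    case (Suc n)
    note tails = Suc.prems(1-3)[THEN binary_expansion_tail]
    have "d 0 \<in> {0, 1}" "e 0 \<in> {0, 1}" "f 0 \<in> {0, 1}"
      using Suc.prems(1-3) unfolding binary_expansion_def by blast+
    then have "gap x y z = gap (2 * x - real (d 0)) (2 * y - real (e 0)) (2 * z - real (f 0)) / 8"
      using gap_even[OF tails[THEN binary_expansion_bounds], of "d 0" "e 0" "f 0"] Suc.prems(4)[of 0] by simp
    then show ?case using Suc.IH[OF tails Suc.prems(4)] by simp
  qed
  moreover have "(\<lambda>n. M * (1/8) ^ n) \<longlonglongrightarrow> M * 0"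
    by (intro tendsto_intros LIMSEQ_power_zero) simp
  then have "(\<lambda>n. M / 8 ^ n) \<longlonglongrightarrow> 0" by (simp add: power_one_over)
  ultimately have "\<bar>gap x y z\<bar> \<le> 0" by (intro LIMSEQ_le_const) auto
  then show ?thesis by simp
qed

lemma xor_zero_set_child:
  assumes xor: "(x, y, z) \<in> xor_zero_set" and lt: "x < 1" "y < 1" "z < 1"
    and digits: "a \<in> {0, 1}" "b \<in> {0, 1}" "c \<in> {0, 1}" "even (a + b + c)"
  shows "((x + real a) / 2, (y + real b) / 2, (z + real c) / 2) \<in> xor_zero_set"
proof -
  have "binary_digit ((t + real k) / 2) = case_nat k (binary_digit t)"
    if "t \<in> {0..1}" "t < 1" "k \<in> {0, 1}" for t k
    using that by (intro binary_digit_eqI binary_expansion_child binary_expansion_binary_digit)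
  then show ?thesis using assms unfolding xor_zero_set_def
    by (auto simp: mod_2_eq_odd split: nat.split)
qed

text \<open>Even children are followed for \<open>n\<close> levels, and the walk then ends at the
  origin: the approximants carry \<open>n\<close> chosen digits followed by zeros. The bounds below
  1 keep \<open>xor_zero_set_child\<close> applicable.\<close>

lemma xor_zero_set_dense:
  assumes "x \<in> {0..1}" "y \<in> {0..1}" "z \<in> {0..1}" "gap x y z = 0"
  shows "\<exists>p q r. (p, q, r) \<in> xor_zero_set \<and> p < 1 \<and> q < 1 \<and> r < 1
    \<and> \<bar>x - p\<bar> \<le> 1 / 2 ^ n \<and> \<bar>y - q\<bar> \<le> 1 / 2 ^ n \<and> \<bar>z - r\<bar> \<le> 1 / 2 ^ n"
  using assms
proof (induction n arbitrary: x y z)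
  case 0
  have "binary_expansion 0 (\<lambda>_. 0)" by (simp add: binary_expansion_def)
  then have "(0, 0, 0) \<in> xor_zero_set" by (simp add: xor_zero_set_def binary_digit_eqI)
  then show ?case using 0 by (intro exI[of _ 0]) auto
next
  case (Suc n)
  obtain x' y' z' a b c where child: "even_child x y z x' y' z' a b c" "gap x' y' z' = 0"
    using gap_zero_child[OF Suc.prems] .
  then obtain p q r where pqr: "(p, q, r) \<in> xor_zero_set" "p < 1" "q < 1" "r < 1"
    "\<bar>x' - p\<bar> \<le> 1 / 2 ^ n" "\<bar>y' - q\<bar> \<le> 1 / 2 ^ n" "\<bar>z' - r\<bar> \<le> 1 / 2 ^ n"
    using Suc.IH[of x' y' z'] unfolding even_child_def by blast
  have digits: "a \<in> {0, 1}" "b \<in> {0, 1}" "c \<in> {0, 1}" "even (a + b + c)"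
    and xyz: "x = (x' + real a) / 2" "y = (y' + real b) / 2" "z = (z' + real c) / 2"
    using child(1) unfolding even_child_def by blast+
  have halve: "\<bar>(t + real k) / 2 - (u + real k) / 2\<bar> \<le> 1 / 2 ^ Suc n" if "\<bar>t - u\<bar> \<le> 1 / 2 ^ n" for t u k
  proof -
    have "\<bar>(t + real k) / 2 - (u + real k) / 2\<bar> = \<bar>t - u\<bar> / 2" by (simp flip: diff_divide_distrib)
    also have "\<dots> \<le> 1 / 2 ^ n / 2" using that by (rule divide_right_mono) simp
    finally show ?thesis by simp
  qed
  have lt: "(t + real k) / 2 < 1" if "t < 1" "k \<in> {0, 1}" for t k using that by auto
  show ?case unfolding xyz
    using xor_zero_set_child[OF pqr(1-4) digits] lt[OF pqr(2) digits(1)] lt[OF pqr(3) digits(2)] lt[OF pqr(4) digits(3)]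
      halve[OF pqr(5)] halve[OF pqr(6)] halve[OF pqr(7)] by blast
qed

text \<open>The closure accounts for the second expansions of dyadic numbers: (1/2, 1/2, 1) is a
  zero of \<open>gap\<close> through 0.0111..., 0.1000... and 0.111..., but does not belong to
  \<open>xor_zero_set\<close>.\<close>

lemma closure_xor_zero_set:
  "closure xor_zero_set = {(x, y, z). x \<in> {0..1} \<and> y \<in> {0..1} \<and> z \<in> {0..1} \<and> gap x y z = 0}" (is "_ = ?Z")
proof
  have "?Z = ({0..1} \<times> {0..1} \<times> {0..1}) \<inter> (\<lambda>(x, y, z). gap x y z) -` {0}" by auto
  also have "closed \<dots>"
    by (intro closed_Int closed_Times closed_vimage continuous_on_gap) auto
  finally have "closed ?Z" .
  moreover have "xor_zero_set \<subseteq> ?Z"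
    unfolding xor_zero_set_def
    by (auto intro!: gap_zero_of_digits[OF binary_expansion_binary_digit binary_expansion_binary_digit binary_expansion_binary_digit]
        simp: mod_eq_0_iff_dvd)
  ultimately show "closure xor_zero_set \<subseteq> ?Z" by (rule closure_minimal[rotated])
  show "?Z \<subseteq> closure xor_zero_set"
  proof clarify
    fix x y z assume xyz: "x \<in> {0..1}" "y \<in> {0..1}" "z \<in> {0..1}" "gap x y z = 0"
    show "(x, y, z) \<in> closure xor_zero_set"
      unfolding closure_approachable
    proof (intro allI impI)
      fix e :: real assume "e > 0"
      then obtain n where n: "(1/2) ^ n < e / 3" using real_arch_pow_inv[of "e / 3" "1/2"] by auto
      obtain p q r where pqr: "(p, q, r) \<in> xor_zero_set"
        "\<bar>x - p\<bar> \<le> 1 / 2 ^ n" "\<bar>y - q\<bar> \<le> 1 / 2 ^ n" "\<bar>z - r\<bar> \<le> 1 / 2 ^ n"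
        using xor_zero_set_dense[OF xyz] by blast
      have "dist (p, q, r) (x, y, z) \<le> \<bar>p - x\<bar> + (\<bar>q - y\<bar> + \<bar>r - z\<bar>)"
        unfolding dist_Pair_Pair dist_real_def
        using sqrt_sum_squares_le_sum_abs[of "\<bar>p - x\<bar>" "sqrt (\<bar>q - y\<bar>\<^sup>2 + \<bar>r - z\<bar>\<^sup>2)"] sqrt_sum_squares_le_sum_abs[of "\<bar>q - y\<bar>" "\<bar>r - z\<bar>"]
        by simp
      also have "\<dots> < e" using pqr(2-4) n by (simp add: power_one_over abs_minus_commute)
      finally show "\<exists>p\<in>xor_zero_set. dist p (x, y, z) < e" using pqr(1) by blast
    qed
  qed
qed

section \<open>The dual problem\<close>

lemma lebesgue_integral_AE_eq_lborel:
  fixes f g :: "'a::euclidean_space \<Rightarrow> real"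
  assumes g: "integrable lborel g" and ae: "AE x in lborel. f x = g x"
  shows "integrable lebesgue f" "integral\<^sup>L lebesgue f = integral\<^sup>L lborel g"
proof -
  have g': "integrable lebesgue g" using g by (subst integrable_completion) auto
  have ae': "AE x in lebesgue. g x = f x" using AE_completion[OF ae] by (rule AE_mp) auto
  have f: "f \<in> borel_measurable lebesgue"
    using borel_measurable_AE[OF borel_measurable_integrable[OF g'] ae'] .
  show "integrable lebesgue f" by (rule integrable_cong_AE_imp[OF g' f ae'])
  have "integral\<^sup>L lebesgue f = integral\<^sup>L lebesgue g"
    using ae' by (intro integral_cong_AE[OF f borel_measurable_integrable[OF g']]) auto
  then show "integral\<^sup>L lebesgue f = integral\<^sup>L lborel g"
    using g by (subst (asm) integral_completion) auto
qed

lemma lebesgue_integrable_lborel_version: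
  fixes f :: "'a::euclidean_space \<Rightarrow> real"
  assumes f: "integrable lebesgue f"
  obtains g where "integrable lborel g" "AE x in lborel. f x = g x"
proof -
  obtain g where g: "g \<in> borel_measurable lborel" "AE x in lborel. f x = g x"
    using completion_ex_borel_measurable_real[OF borel_measurable_integrable[OF f]] by blast
  have "integrable lebesgue g"
    using integrable_cong_AE_imp[OF f] g measurable_completion[OF g(1)] AE_completion[OF g(2)] by blast
  then have "integrable lborel g" using g(1) by (subst (asm) integrable_completion)
  then show ?thesis using that g(2) by blast
qed

text \<open>Lebesgue measure on the plane is the completion of
  \<open>lborel \<Otimes>\<^sub>M lborel\<close>. Fubini is applied to a Borel function equal to
  \<open>f\<close> almost everywhere; almost all slices then agree almost everywhere.\<close>

lemma Fubini_lebesgue: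
  fixes f :: "real \<times> real \<Rightarrow> real"
  assumes f: "integrable lebesgue f"
  shows "AE x in lebesgue. integrable lebesgue (\<lambda>y. f (x, y))"
    and "integrable lebesgue (\<lambda>x. LINT y|lebesgue. f (x, y))"
    and "(LINT x|lebesgue. LINT y|lebesgue. f (x, y)) = integral\<^sup>L lebesgue f"
proof -
  obtain g where g: "integrable lborel g" and ae: "AE p in lborel. f p = g p"
    using lebesgue_integrable_lborel_version[OF f] .
  have g': "integrable (lborel \<Otimes>\<^sub>M lborel) g" using g by (simp add: lborel_prod)
  have "AE p in lborel \<Otimes>\<^sub>M lborel. f p = g p" using ae unfolding lborel_prod .
  then have "AE x in lborel. AE y in lborel. f (x, y) = g (x, y)" by (rule lborel_pair.AE_pair)
  moreover have "AE x in lborel. integrable lborel (\<lambda>y. g (x, y))"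
    by (rule lborel_pair.AE_integrable_fst'[OF g'])
  ultimately have slices: "AE x in lborel. integrable lebesgue (\<lambda>y. f (x, y))
      \<and> (LINT y|lebesgue. f (x, y)) = (LINT y|lborel. g (x, y))"
    by eventually_elim (auto intro: lebesgue_integral_AE_eq_lborel)
  then show "AE x in lebesgue. integrable lebesgue (\<lambda>y. f (x, y))"
    by (intro AE_completion) (auto elim: AE_mp)
  have *: "AE x in lborel. (LINT y|lebesgue. f (x, y)) = (LINT y|lborel. g (x, y))"
    using slices by eventually_elim simp
  note outer = lebesgue_integral_AE_eq_lborel[OF lborel_pair.integrable_fst'[OF g'] *]
  show "integrable lebesgue (\<lambda>x. LINT y|lebesgue. f (x, y))" by (rule outer(1))
  show "(LINT x|lebesgue. LINT y|lebesgue. f (x, y)) = integral\<^sup>L lebesgue f"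
    using outer(2) lborel_pair.integral_fst'[OF g'] lebesgue_integral_AE_eq_lborel(2)[OF g ae]
    by (simp add: lborel_prod)
qed

text \<open>This provides the other order of integration. The exceptional null set is carried over
  by invariance of the product measure under the swap.\<close>

lemma lebesgue_integral_swap:
  fixes f :: "real \<times> real \<Rightarrow> real"
  assumes f: "integrable lebesgue f"
  shows "integrable lebesgue (\<lambda>(x, y). f (y, x))"
    and "(LINT (x, y)|lebesgue. f (y, x)) = integral\<^sup>L lebesgue f"
proof -
  obtain g where g: "integrable lborel g" and ae: "AE p in lborel. f p = g p"
    using lebesgue_integrable_lborel_version[OF f] .
  have g': "integrable (lborel \<Otimes>\<^sub>M lborel) g" using g by (simp add: lborel_prod)
  have "AE p in lborel \<Otimes>\<^sub>M lborel. f p = g p" using ae unfolding lborel_prod .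
  then have "AE p in distr (lborel \<Otimes>\<^sub>M lborel) (lborel \<Otimes>\<^sub>M lborel) (\<lambda>(x, y). (y, x)). f p = g p"
    by (simp only: lborel_pair.distr_pair_swap[symmetric])
  then have "AE p in lborel \<Otimes>\<^sub>M lborel. f ((\<lambda>(x, y). (y, x)) p) = g ((\<lambda>(x, y). (y, x)) p)"
    by (rule AE_distrD[rotated]) simp
  then have ae': "AE p in lborel. (\<lambda>(x, y). f (y, x)) p = (\<lambda>(x, y). g (y, x)) p"
    unfolding lborel_prod case_prod_unfold by simp
  have g_swap: "integrable lborel (\<lambda>(x, y). g (y, x))"
    using lborel_pair.integrable_product_swap[OF g'] by (simp add: lborel_prod)
  note swap = lebesgue_integral_AE_eq_lborel[OF g_swap ae']
  show "integrable lebesgue (\<lambda>(x, y). f (y, x))" by (rule swap(1))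
  show "(LINT (x, y)|lebesgue. f (y, x)) = integral\<^sup>L lebesgue f"
    using swap(2) lborel_pair.integral_product_swap[of g] g' lebesgue_integral_AE_eq_lborel(2)[OF g ae]
    by (simp add: lborel_prod borel_measurable_integrable)
qed

text \<open>The inequality is integrated over \<open>x\<close>, \<open>y\<close> and
  \<open>z\<close> in turn, and each indicator on the left integrates to 1 over the variable missing
  from its function. Slices are integrable only almost everywhere, hence the almost-everywhere
  inequalities in \<open>y\<close> and \<open>z\<close>.\<close>

lemma sum_integrals_le:
  fixes A B C :: "real \<times> real \<Rightarrow> real"
  assumes A: "integrable lebesgue A" and B: "integrable lebesgue B" and C: "integrable lebesgue C"
    and le: "\<And>x y z. indicator {0..1} z * A (x, y) + indicator {0..1} x * B (y, z) + indicator {0..1} y * C (z, x)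
      \<le> M * (indicator {0..1} x * indicator {0..1} y * indicator {0..1} z)"
  shows "integral\<^sup>L lebesgue A + integral\<^sup>L lebesgue B + integral\<^sup>L lebesgue C \<le> M"
proof -
  define u :: "real \<Rightarrow> real" where "u = indicator {0..1}"
  have u_int: "integrable lebesgue u" and u1: "integral\<^sup>L lebesgue u = 1"
    unfolding u_def by (auto simp: integrable_real_indicator)
  define a where "a y = (LINT x|lebesgue. A (x, y))" for y
  define b where "b z = (LINT y|lebesgue. B (y, z))" for z
  define c where "c z = (LINT x|lebesgue. C (z, x))" for z
  \<comment> \<open>The swaps leave \<open>y\<close> as the outer variable for \<open>A\<close> and
    \<open>z\<close> for \<open>B\<close>; \<open>C\<close> has \<open>z\<close> outside
    already.\<close>
  note FA = Fubini_lebesgue[OF lebesgue_integral_swap(1)[OF A], simplified, folded a_def]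
  note FB = Fubini_lebesgue[OF lebesgue_integral_swap(1)[OF B], simplified, folded b_def]
  note FC = Fubini_lebesgue[OF C, folded c_def]
  have IA: "integral\<^sup>L lebesgue a = integral\<^sup>L lebesgue A"
    and IB: "integral\<^sup>L lebesgue b = integral\<^sup>L lebesgue B"
    and IC: "integral\<^sup>L lebesgue c = integral\<^sup>L lebesgue C"
    using FA(3) FB(3) FC(3) lebesgue_integral_swap(2)[OF A] lebesgue_integral_swap(2)[OF B] by simp_all
  have "AE z in lebesgue. u z * integral\<^sup>L lebesgue A + b z + c z \<le> M * u z"
    using FB(1) FC(1)
  proof eventually_elim
    case (elim z)
    have "AE y in lebesgue. u z * a y + B (y, z) + u y * c z \<le> M * u z * u y"
      using FA(1)
    proof eventually_elim
      case (elim y)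
      have "(LINT x|lebesgue. u z * A (x, y) + u x * B (y, z) + u y * C (z, x)) \<le> (LINT x|lebesgue. (M * u z * u y) * u x)"
        using elim \<open>integrable lebesgue (\<lambda>y. C (z, y))\<close> le[of z _ y]
        by (intro integral_mono Bochner_Integration.integrable_add integrable_mult_right integrable_mult_left u_int)
           (auto simp: u_def mult_ac)
      also have "(LINT x|lebesgue. u z * A (x, y) + u x * B (y, z) + u y * C (z, x)) = u z * a y + B (y, z) + u y * c z"
        using elim \<open>integrable lebesgue (\<lambda>y. C (z, y))\<close> u_int u1 by (simp add: a_def c_def)
      finally show ?case using u1 by simp
    qed
    then have "(LINT y|lebesgue. u z * a y + B (y, z) + u y * c z) \<le> (LINT y|lebesgue. M * u z * u y)"
      using elim FA(2)
      by (intro integral_mono_AE Bochner_Integration.integrable_add integrable_mult_right integrable_mult_left u_int) auto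
    also have "(LINT y|lebesgue. u z * a y + B (y, z) + u y * c z) = u z * integral\<^sup>L lebesgue A + b z + c z"
      using elim FA(2) u_int u1 IA by (simp add: b_def)
    finally show ?case using u1 by simp
  qed
  then have "(LINT z|lebesgue. u z * integral\<^sup>L lebesgue A + b z + c z) \<le> (LINT z|lebesgue. M * u z)"
    using FB(2) FC(2)
    by (intro integral_mono_AE Bochner_Integration.integrable_add integrable_mult_right integrable_mult_left u_int) auto
  then show ?thesis using FB(2) FC(2) u_int u1 IB IC by simp
qed

lemma sum_set_integrals_le:
  fixes A B C :: "real \<times> real \<Rightarrow> real"
  assumes "set_integrable lebesgue unit_square A" "set_integrable lebesgue unit_square B" "set_integrable lebesgue unit_square C"
    and le: "\<And>x y z. x \<in> {0..1} \<Longrightarrow> y \<in> {0..1} \<Longrightarrow> z \<in> {0..1} \<Longrightarrow> A (x, y) + B (y, z) + C (z, x) \<le> M"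
  shows "dual_value (A, B, C) \<le> M"
  unfolding dual_value_def set_lebesgue_integral_def prod.case
proof (rule sum_integrals_le)
  fix x y z :: real
  show "indicator {0..1} z * (indicator unit_square (x, y) *\<^sub>R A (x, y)) + indicator {0..1} x * (indicator unit_square (y, z) *\<^sub>R B (y, z))
     + indicator {0..1} y * (indicator unit_square (z, x) *\<^sub>R C (z, x))
      \<le> M * (indicator {0..1} x * indicator {0..1} y * indicator {0..1} z)"
    using le[of x y z] by (auto simp: unit_square_def indicator_times split: split_indicator)
qed (use assms in \<open>auto simp: set_integrable_def\<close>)

text \<open>Averaging the three potentials over the half-size subsquares keeps their integrals, and matching
  the subsquares along the four subcubes of even parity turns a bound by \<open>gap\<close> into one by \<open>gap / 8\<close>.\<close>

definition child_average :: "(real \<times> real \<Rightarrow> real) \<Rightarrow> real \<times> real \<Rightarrow> real" where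
  "child_average f = (\<lambda>(x, y). (f (x / 2, y / 2) + f (x / 2, (y + 1) / 2)
     + f ((x + 1) / 2, y / 2) + f ((x + 1) / 2, (y + 1) / 2)) / 4)"

section \<open>Integrals of averages over subsquares\<close>

lemma unit_square_cbox: "unit_square = cbox (0, 0) (1, 1)"
  by (auto simp: unit_square_def cbox_Pair_iff)

text \<open>The factor 4 compensates for halving both coordinates.\<close>

lemma has_integral_child:
  fixes f :: "real \<times> real \<Rightarrow> real"
  assumes "f integrable_on unit_square" "0 \<le> a" "a \<le> 1/2" "0 \<le> b" "b \<le> 1/2"
  shows "((\<lambda>(x, y). f (x / 2 + a, y / 2 + b)) has_integral
    4 * integral (cbox (a, b) (a + 1/2, b + 1/2)) f) unit_square"
proof -
  have "f integrable_on cbox (a, b) (a + 1/2, b + 1/2)"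
    using assms by (intro integrable_on_subcbox[OF assms(1)[unfolded unit_square_cbox]]) (auto simp: cbox_Pair_iff)
  then have "(f has_integral integral (cbox (a, b) (a + 1/2, b + 1/2)) f) (cbox (a, b) (a + 1/2, b + 1/2))"
    by (rule integrable_integral)
  from has_integral_affinity'[OF this, of "1/2" "(a, b)"]
  have "((\<lambda>p. f ((1/2) *\<^sub>R p + (a, b))) has_integral
      4 * integral (cbox (a, b) (a + 1/2, b + 1/2)) f) (cbox (0, 0) (1, 1))"
    by (simp add: zero_prod_def power2_eq_square)
  moreover have "(1/2) *\<^sub>R p + (a, b) = (fst p / 2 + a, snd p / 2 + b)" for p :: "real \<times> real"
    by (cases p) simp
  ultimately show ?thesis by (simp add: unit_square_cbox case_prod_unfold)
qed

lemma integral_unit_square_split: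
  fixes f :: "real \<times> real \<Rightarrow> real"
  assumes f: "f integrable_on unit_square"
  shows "integral unit_square f =
    integral (cbox (0, 0) (1/2, 1/2)) f + integral (cbox (0, 1/2) (1/2, 1)) f
    + integral (cbox (1/2, 0) (1, 1/2)) f + integral (cbox (1/2, 1/2) (1, 1)) f"
proof -
  have basis: "(1, 0) \<in> (Basis :: (real \<times> real) set)" "(0, 1) \<in> (Basis :: (real \<times> real) set)" by (simp_all add: Basis_prod_def image_iff)
  have "integral unit_square f = integral (cbox (0, 0) (1/2, 1)) f + integral (cbox (1/2, 0) (1, 1)) f"
  proof -
    have "cbox (0, 0) (1, 1) \<inter> {p::real\<times>real. p \<bullet> (1, 0) \<le> 1/2} = cbox (0, 0) (1/2, 1)"
      "cbox (0, 0) (1, 1) \<inter> {p::real\<times>real. p \<bullet> (1, 0) \<ge> 1/2} = cbox (1/2, 0) (1, 1)"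
      by (auto simp: cbox_Pair_iff)
    then show ?thesis using integral_split[OF f[unfolded unit_square_cbox] basis(1), of "1/2"]
      by (simp only: unit_square_cbox)
  qed
  moreover have "integral (cbox (l, 0) (r, 1)) f = integral (cbox (l, 0) (r, 1/2)) f + integral (cbox (l, 1/2) (r, 1)) f"
    if "0 \<le> l" "r \<le> 1" for l r
  proof -
    have "cbox (l, 0) (r, 1) \<inter> {p::real\<times>real. p \<bullet> (0, 1) \<le> 1/2} = cbox (l, 0) (r, 1/2)"
      "cbox (l, 0) (r, 1) \<inter> {p::real\<times>real. p \<bullet> (0, 1) \<ge> 1/2} = cbox (l, 1/2) (r, 1)"
      by (auto simp: cbox_Pair_iff)
    moreover have "f integrable_on cbox (l, 0) (r, 1)"
      using that by (intro integrable_on_subcbox[OF f[unfolded unit_square_cbox]]) (auto simp: cbox_Pair_iff)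
    ultimately show ?thesis using integral_split[of f _ _ "(0, 1)" "1/2"] basis(2) by metis
  qed
  ultimately show ?thesis by simp
qed

lemma child_average_has_integral:
  assumes f: "f integrable_on unit_square"
  shows "(child_average f has_integral integral unit_square f) unit_square"
proof -
  note c = has_integral_child[OF f]
  have "((\<lambda>p. ((\<lambda>(x, y). f (x / 2 + 0, y / 2 + 0)) p + (\<lambda>(x, y). f (x / 2 + 0, y / 2 + 1/2)) p
     + (\<lambda>(x, y). f (x / 2 + 1/2, y / 2 + 0)) p + (\<lambda>(x, y). f (x / 2 + 1/2, y / 2 + 1/2)) p) / 4) has_integral
    (4 * integral (cbox (0, 0) (0 + 1/2, 0 + 1/2)) f + 4 * integral (cbox (0, 1/2) (0 + 1/2, 1/2 + 1/2)) f
    + 4 * integral (cbox (1/2, 0) (1/2 + 1/2, 0 + 1/2)) f + 4 * integral (cbox (1/2, 1/2) (1/2 + 1/2, 1/2 + 1/2)) f) / 4) unit_square"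
    by (intro has_integral_divide has_integral_add c) auto
  then show ?thesis unfolding integral_unit_square_split[OF f] child_average_def
    by (simp add: case_prod_unfold add_divide_distrib)
qed

lemma child_average_set_integral:
  assumes f: "set_integrable lebesgue unit_square f"
  shows "set_integrable lebesgue unit_square (child_average f)"
    and "set_lebesgue_integral lebesgue unit_square (child_average f) = set_lebesgue_integral lebesgue unit_square f"
proof -
  have f': "f integrable_on unit_square" "(\<lambda>p. norm (f p)) integrable_on unit_square"
    using f by (auto simp: absolutely_integrable_on_def)
  show *: "set_integrable lebesgue unit_square (child_average f)"
  \<comment> \<open>The average of the norms dominates and is integrable by
    \<open>child_average_has_integral\<close>, so the integrability is absolute.\<close>
  proof (rule absolutely_integrable_integrable_bound)
    show "norm (child_average f p) \<le> child_average (\<lambda>p. norm (f p)) p" for p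
      by (cases p) (auto simp: child_average_def)
  qed (use child_average_has_integral[OF f'(1)] child_average_has_integral[OF f'(2)] in \<open>auto simp: integrable_on_def\<close>)
  show "set_lebesgue_integral lebesgue unit_square (child_average f) = set_lebesgue_integral lebesgue unit_square f"
    using child_average_has_integral[OF f'(1)] by (simp add: set_lebesgue_integral_eq_integral(2) f * integral_unique)
qed

text \<open>The potentials and \<open>m\<close> vary in the induction: one averaging keeps the dual
  value and raises \<open>m\<close> by 1. The constant \<open>M\<close> enters only at the
  end.\<close>

lemma dual_value_le_of_le_gap:
  assumes M: "\<And>x y z. x \<in> {0..1} \<Longrightarrow> y \<in> {0..1} \<Longrightarrow> z \<in> {0..1} \<Longrightarrow> gap x y z \<le> M"
    and int: "set_integrable lebesgue unit_square A" "set_integrable lebesgue unit_square B" "set_integrable lebesgue unit_square C"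
    and le: "\<And>x y z. x \<in> {0..1} \<Longrightarrow> y \<in> {0..1} \<Longrightarrow> z \<in> {0..1} \<Longrightarrow> A (x, y) + B (y, z) + C (z, x) \<le> gap x y z / 8 ^ m"
  shows "dual_value (A, B, C) \<le> M / 8 ^ (m + n)"
  using int le
proof (induction n arbitrary: A B C m)
  case 0
  have "A (x, y) + B (y, z) + C (z, x) \<le> M / 8 ^ m" if "x \<in> {0..1}" "y \<in> {0..1}" "z \<in> {0..1}" for x y z
    using 0(4)[OF that] divide_right_mono[OF M[OF that], of "8 ^ m"] by simp
  then show ?case using sum_set_integrals_le[OF 0(1-3)] by simp
next
  case (Suc n)
  have "dual_value (child_average A, child_average B, child_average C) \<le> M / 8 ^ (Suc m + n)"
  proof (rule Suc.IH)
    fix x y z :: real assume xyz: "x \<in> {0..1}" "y \<in> {0..1}" "z \<in> {0..1}"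
    \<comment> \<open>Indices 1 to 4 stand for the digit pairs 00, 01, 10, 11. The premises belong
      to the subcubes 000, 110, 101, 011, and each of the twelve subsquares occurs exactly
      once.\<close>
    have average: "(a1 + a2 + a3 + a4) / 4 + (b1 + b2 + b3 + b4) / 4 + (c1 + c2 + c3 + c4) / 4 \<le> q"
      if "a1 + b1 + c1 \<le> q" "a4 + b3 + c2 \<le> q" "a3 + b2 + c4 \<le> q" "a2 + b4 + c3 \<le> q"
      for a1 a2 a3 a4 b1 b2 b3 b4 c1 c2 c3 c4 q :: real
      using that by argo
    define q where "q = gap x y z / 8 / 8 ^ m"
    have q: "gap x y z / 8 ^ Suc m = q" by (simp add: q_def)
    have child: "A ((x + real a) / 2, (y + real b) / 2) + B ((y + real b) / 2, (z + real c) / 2) + C ((z + real c) / 2, (x + real a) / 2)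
       \<le> q" if "a \<in> {0, 1}" "b \<in> {0, 1}" "c \<in> {0, 1}" "even (a + b + c)" for a b c
    proof -
      have "(t + real k) / 2 \<in> {0..1}" if "t \<in> {0..1}" "k \<in> {0, 1}" for t k using that by auto
      then show ?thesis using Suc.prems(4)[of "(x + real a) / 2" "(y + real b) / 2" "(z + real c) / 2"] xyz that
        by (simp only: gap_even[OF xyz that] q_def)
    qed
    show "child_average A (x, y) + child_average B (y, z) + child_average C (z, x) \<le> gap x y z / 8 ^ Suc m"
      unfolding child_average_def prod.case q
      by (rule average) (use child[of 0 0 0] child[of 1 1 0] child[of 1 0 1] child[of 0 1 1] in simp_all)
  qed (use Suc.prems in \<open>auto intro: child_average_set_integral\<close>)
  then show ?case using Suc.prems(1-3) by (simp add: dual_value_def child_average_set_integral)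
qed

section \<open>Optimality of the potentials\<close>

lemma set_integrable_f_C: "set_integrable lebesgue unit_square f_C"
  using continuous_on_f_C unfolding unit_square_cbox by (rule absolutely_integrable_continuous)

lemma f_C_optimal: "is_arg_max dual_value dual_feasible (\<lambda>p. f_C p / 8, \<lambda>p. f_C p / 8, \<lambda>p. f_C p / 8)"
  unfolding is_arg_max_def
proof (intro conjI notI)
  have int: "set_integrable lebesgue unit_square (\<lambda>p. f_C p / 8)"
    using set_integrable_f_C by (rule set_integrable_divide)
  have "f_C (x, y) / 8 + f_C (y, z) / 8 + f_C (z, x) / 8 \<le> x * y * z"
    if "x \<in> {0..1}" "y \<in> {0..1}" "z \<in> {0..1}" for x y z
    using gap_nonneg[OF that] gap_eq_F_C[OF that] by (simp add: F_C_def)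
  then show "dual_feasible (\<lambda>p. f_C p / 8, \<lambda>p. f_C p / 8, \<lambda>p. f_C p / 8)"
    using int by (simp add: dual_feasible_def)
  assume "\<exists>y. dual_feasible y \<and> dual_value (\<lambda>p. f_C p / 8, \<lambda>p. f_C p / 8, \<lambda>p. f_C p / 8) < dual_value y"
  then obtain F G H where feas: "dual_feasible (F, G, H)"
    and less: "dual_value (\<lambda>p. f_C p / 8, \<lambda>p. f_C p / 8, \<lambda>p. f_C p / 8) < dual_value (F, G, H)"
    by (metis prod_cases3)
  have ints: "set_integrable lebesgue unit_square F" "set_integrable lebesgue unit_square G" "set_integrable lebesgue unit_square H"
    and le: "\<And>x y z. x \<in> {0..1} \<Longrightarrow> y \<in> {0..1} \<Longrightarrow> z \<in> {0..1} \<Longrightarrow> F (x, y) + G (y, z) + H (z, x) \<le> x * y * z"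
    using feas by (auto simp: dual_feasible_def)
  obtain M where M: "\<bar>gap x y z\<bar> \<le> M" if "x \<in> {0..1}" "y \<in> {0..1}" "z \<in> {0..1}" for x y z
    using gap_bounded by blast
  let ?A = "\<lambda>p. F p - f_C p / 8" let ?B = "\<lambda>p. G p - f_C p / 8" let ?C = "\<lambda>p. H p - f_C p / 8"
  \<comment> \<open>The induction starts at exponent 1 because
    \<open>x * y * z - F_C x y z / 8\<close> is \<open>gap x y z / 8\<close>.\<close>
  have "?A (x, y) + ?B (y, z) + ?C (z, x) \<le> gap x y z / 8 ^ 1" if "x \<in> {0..1}" "y \<in> {0..1}" "z \<in> {0..1}" for x y z
    using le[OF that] gap_eq_F_C[OF that] by (simp add: F_C_def)
  then have "dual_value (?A, ?B, ?C) \<le> M / 8 ^ (1 + n)" for n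
    using M ints int by (intro dual_value_le_of_le_gap set_integral_diff(1)) (auto simp: abs_le_iff)
  moreover have "(\<lambda>n. M / 8 * (1/8) ^ n) \<longlonglongrightarrow> M / 8 * 0"
    by (intro tendsto_intros LIMSEQ_power_zero) simp
  then have "(\<lambda>n. M / 8 ^ (1 + n)) \<longlonglongrightarrow> 0" by (simp add: power_one_over)
  ultimately have "dual_value (?A, ?B, ?C) \<le> 0" by (intro LIMSEQ_le_const) auto
  moreover have "dual_value (?A, ?B, ?C) = dual_value (F, G, H) - dual_value (\<lambda>p. f_C p / 8, \<lambda>p. f_C p / 8, \<lambda>p. f_C p / 8)"
    using ints int by (simp add: dual_value_def set_integral_diff(2))
  ultimately show False using less by simp
qed

theorem theorem6p5:
  shows "(\<forall>x\<in>{0..1}. \<forall>y\<in>{0..1}. \<forall>z\<in>{0..1}.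
            F_C x y z \<le> 8 * x * y * z
            \<and> (F_C x y z = 8 * x * y * z \<longleftrightarrow> (x, y, z) \<in> closure xor_zero_set))
         \<and> is_arg_max dual_value dual_feasible
             (\<lambda>(x, y). f_C (x, y) / 8, \<lambda>(y, z). f_C (y, z) / 8, \<lambda>(z, x). f_C (z, x) / 8)"
proof (intro conjI ballI)
  fix x y z :: real
  assume xyz: "x \<in> {0..1}" "y \<in> {0..1}" "z \<in> {0..1}"
  show "F_C x y z \<le> 8 * x * y * z"
    using gap_nonneg[OF xyz] gap_eq_F_C[OF xyz] by simp
  show "F_C x y z = 8 * x * y * z \<longleftrightarrow> (x, y, z) \<in> closure xor_zero_set"
    using xyz gap_eq_F_C[OF xyz] by (auto simp: closure_xor_zero_set)
next
  show "is_arg_max dual_value dual_feasible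
      (\<lambda>(x, y). f_C (x, y) / 8, \<lambda>(y, z). f_C (y, z) / 8, \<lambda>(z, x). f_C (z, x) / 8)"
    using f_C_optimal by (simp add: case_prod_unfold)
qed

end
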